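(* Let $\ell,m_0\in\mathbb{C}$ be such that $q^{2m_0+k}\neq -1$ for all $k\in\mathbb{Z}$. Then the representation $V_{m_0}^{\ell}$ of $U_q^{\mathrm{tw}}(\mathfrak{so}_3)$ has (finite) length at most $3$.
   Context: Fix $h\in\mathbb{C}\setminus 2\pi i\mathbb{Q}$, where $i=\sqrt{-1}$, and put $q=\exp(h)$, so $q$ is not a root of unity. For $b\in\mathbb{C}$ put $q^b=\exp(hb)$ and $[b]=\frac{q^b-q^{-b}}{q-q^{-1}}$. The algebra $U_q^{\mathrm{tw}}(\mathfrak{so}_3)$ is the complex unital associative algebra generated by $I_{21},I_{32}$ subject to $$I_{32}^2I_{21}-[2]I_{32}I_{21}I_{32}+I_{21}I_{32}^2=-I_{21},\qquad I_{21}^2I_{32}-[2]I_{21}I_{32}I_{21}+I_{32}I_{21}^2=-I_{32}.$$ For $\ell,m_0\in\mathbb{C}$ with $q^{2m}\neq -1$ for all $m\in m_0+\mathbb{Z}$, $V_{m_0}^{\ell}=\bigoplus_{m\in m_0+\mathbb{Z}}\mathbb{C}\,|m\rangle$ is the representation of $U_q^{\mathrm{tw}}(\mathfrak{so}_3)$ with basis $\{|m\rangle : m\in m_0+\mathbb{Z}\}$ and action $$I_{21}.|m\rangle=i[m]\,|m\rangle,\qquad I_{32}.|m\rangle=\frac{[\ell+m+1][\ell-m]}{(q^{m}+q^{-m})(q^{m+1}+q^{-m-1})}\,|m+1\rangle-|m-1\rangle .$$ Length means the length of a composition series as a module. *)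

theory Defs
  imports "HOL-Algebra.Module" "HOL-Algebra.QuotRing" Complex_Main
begin

section \<open>Modules over a ring that need not be commutative\<close>

text \<open>The locale \<open>module\<close> of the library requires a commutative ring of scalars.  The record type
  \<open>module\<close> and the locale \<open>submodule\<close> do not, and are reused here.\<close>

locale left_module = R?: ring R + M?: abelian_group M for R (structure) and M (structure) +
  assumes smult_closed:
      "\<lbrakk>a \<in> carrier R; x \<in> carrier M\<rbrakk> \<Longrightarrow> a \<odot>\<^bsub>M\<^esub> x \<in> carrier M"
    and smult_l_distr:
      "\<lbrakk>a \<in> carrier R; b \<in> carrier R; x \<in> carrier M\<rbrakk> \<Longrightarrow>
        (a \<oplus>\<^bsub>R\<^esub> b) \<odot>\<^bsub>M\<^esub> x = a \<odot>\<^bsub>M\<^esub> x \<oplus>\<^bsub>M\<^esub> b \<odot>\<^bsub>M\<^esub> x"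
    and smult_r_distr:
      "\<lbrakk>a \<in> carrier R; x \<in> carrier M; y \<in> carrier M\<rbrakk> \<Longrightarrow>
        a \<odot>\<^bsub>M\<^esub> (x \<oplus>\<^bsub>M\<^esub> y) = a \<odot>\<^bsub>M\<^esub> x \<oplus>\<^bsub>M\<^esub> a \<odot>\<^bsub>M\<^esub> y"
    and smult_assoc1:
      "\<lbrakk>a \<in> carrier R; b \<in> carrier R; x \<in> carrier M\<rbrakk> \<Longrightarrow>
        (a \<otimes>\<^bsub>R\<^esub> b) \<odot>\<^bsub>M\<^esub> x = a \<odot>\<^bsub>M\<^esub> (b \<odot>\<^bsub>M\<^esub> x)"
    and smult_one:
      "x \<in> carrier M \<Longrightarrow> \<one>\<^bsub>R\<^esub> \<odot>\<^bsub>M\<^esub> x = x"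

text \<open>The fields \<open>mult\<close> and \<open>one\<close> of a \<open>module\<close> record play no role for modules.\<close>

definition quot_module :: "('a, 'b) module \<Rightarrow> 'b set \<Rightarrow> ('a, 'b set) module" where
  "quot_module M N =
    \<lparr>carrier = a_rcosets\<^bsub>M\<^esub> N, mult = (\<lambda>_ _. N), one = N, zero = N, add = set_add M,
     smult = (\<lambda>a X. \<Union>x\<in>X. N +>\<^bsub>M\<^esub> (a \<odot>\<^bsub>M\<^esub> x))\<rparr>"

definition simple_module :: "('a, 'c) ring_scheme \<Rightarrow> ('a, 'b) module \<Rightarrow> bool" where
  "simple_module R M \<longleftrightarrow>
    left_module R M \<and> carrier M \<noteq> {\<zero>\<^bsub>M\<^esub>} \<and>
    (\<forall>H. submodule H R M \<longrightarrow> H = {\<zero>\<^bsub>M\<^esub>} \<or> H = carrier M)"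

definition composition_series ::
    "('a, 'c) ring_scheme \<Rightarrow> ('a, 'b) module \<Rightarrow> (nat \<Rightarrow> 'b set) \<Rightarrow> nat \<Rightarrow> bool" where
  "composition_series R M N n \<longleftrightarrow>
    N 0 = {\<zero>\<^bsub>M\<^esub>} \<and> N n = carrier M \<and>
    (\<forall>j\<le>n. submodule (N j) R M) \<and>
    (\<forall>j<n. N j \<subseteq> N (Suc j) \<and> simple_module R (quot_module (M\<lparr>carrier := N (Suc j)\<rparr>) (N j)))"

definition has_length :: "('a, 'c) ring_scheme \<Rightarrow> ('a, 'b) module \<Rightarrow> nat \<Rightarrow> bool" where
  "has_length R M n \<longleftrightarrow> left_module R M \<and> (\<exists>N. composition_series R M N n)"


section \<open>The algebra\<close>

text \<open>The free unital associative complex algebra on a type of generators: finitely supported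
  coefficient functions on words, multiplied by concatenating words.\<close>

definition free_algebra :: "('g list \<Rightarrow> complex) ring" where
  "free_algebra =
    \<lparr>carrier = {f. finite {w. f w \<noteq> 0}},
     mult = (\<lambda>f g w. \<Sum>(u, v) \<in> {(u, v). u @ v = w}. f u * g v),
     one = (\<lambda>w. if w = [] then 1 else 0),
     zero = (\<lambda>w. 0),
     add = (\<lambda>f g w. f w + g w)\<rparr>"

definition word :: "'g list \<Rightarrow> 'g list \<Rightarrow> complex" where
  "word u = (\<lambda>w. if w = u then 1 else 0)"

definition qpow :: "complex \<Rightarrow> complex \<Rightarrow> complex" where
  "qpow h b = exp (h * b)"

definition qnum :: "complex \<Rightarrow> complex \<Rightarrow> complex" where
  "qnum h b = (qpow h b - qpow h (- b)) / (qpow h 1 - qpow h (- 1))"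

datatype gen = I21 | I32

text \<open>Each relation \<open>a = b\<close> is recorded as the element \<open>a - b\<close>.\<close>

definition so3_relations :: "complex \<Rightarrow> (gen list \<Rightarrow> complex) set" where
  "so3_relations h =
    {(\<lambda>w. word [I32, I32, I21] w - qnum h 2 * word [I32, I21, I32] w
          + word [I21, I32, I32] w + word [I21] w),
     (\<lambda>w. word [I21, I21, I32] w - qnum h 2 * word [I21, I32, I21] w
          + word [I32, I21, I21] w + word [I32] w)}"

text \<open>The scalars are contained in this ring as the multiples of the unit, so that modules
  and submodules over it are automatically complex vector spaces and subspaces.\<close>

definition Uq_tw_so3 :: "complex \<Rightarrow> (gen list \<Rightarrow> complex) set ring" where
  "Uq_tw_so3 h = free_algebra Quot (Idl\<^bsub>free_algebra\<^esub> (so3_relations h))"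


section \<open>The representation\<close>

definition ket :: "complex \<Rightarrow> complex \<Rightarrow> complex" where
  "ket m = (\<lambda>x. if x = m then 1 else 0)"

fun gen_on_ket :: "complex \<Rightarrow> complex \<Rightarrow> gen \<Rightarrow> complex \<Rightarrow> complex \<Rightarrow> complex" where
  "gen_on_ket h l I21 m = (\<lambda>x. \<i> * qnum h m * ket m x)"
| "gen_on_ket h l I32 m = (\<lambda>x.
     qnum h (l + m + 1) * qnum h (l - m)
       / ((qpow h m + qpow h (- m)) * (qpow h (m + 1) + qpow h (- m - 1))) * ket (m + 1) x
     - ket (m - 1) x)"

definition gen_op ::
    "complex \<Rightarrow> complex \<Rightarrow> gen \<Rightarrow> (complex \<Rightarrow> complex) \<Rightarrow> complex \<Rightarrow> complex" where
  "gen_op h l g v = (\<lambda>x. \<Sum>m | v m \<noteq> 0. v m * gen_on_ket h l g m x)"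

definition free_act ::
    "complex \<Rightarrow> complex \<Rightarrow> (gen list \<Rightarrow> complex) \<Rightarrow> (complex \<Rightarrow> complex) \<Rightarrow> complex \<Rightarrow> complex" where
  "free_act h l f v = (\<lambda>x. \<Sum>w | f w \<noteq> 0. f w * foldr (gen_op h l) w v x)"

text \<open>A vector is given by its coefficients with respect to the basis \<open>ket m\<close>, where \<open>m\<close> ranges
  over \<open>m0 + \<int>\<close>.  An element of the algebra, which is a coset, acts through any of its
  representatives.\<close>

definition Vrep ::
    "complex \<Rightarrow> complex \<Rightarrow> complex \<Rightarrow> ((gen list \<Rightarrow> complex) set, complex \<Rightarrow> complex) module" where
  "Vrep h l m0 =
    \<lparr>carrier = {v. finite {m. v m \<noteq> 0} \<and> {m. v m \<noteq> 0} \<subseteq> {m0 + n | n. n \<in> \<int>}},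
     mult = (\<lambda>_ _ _. 0), one = (\<lambda>_. 0),
     zero = (\<lambda>_. 0), add = (\<lambda>v w x. v x + w x),
     smult = (\<lambda>u v. the_elem ((\<lambda>f. free_act h l f v) ` u))\<rparr>"

end

theory Submission
  imports Defs
begin

text \<open>The operator \<open>I21\<close> acts on \<open>ket m\<close> by the scalar \<open>\<i> [m]\<close>, and these scalars are pairwise
  different for \<open>m\<close> in \<open>m0 + \<int>\<close>: if \<open>[m] = [m']\<close>, then \<open>q\<^sup>m = q\<^sup>m'\<close>, which forces \<open>m = m'\<close> because
  \<open>q\<close> is not a root of unity, or \<open>q\<close> to the power \<open>m + m'\<close> is \<open>-1\<close>, which is excluded since
  \<open>m + m'\<close> lies in \<open>2 m0 + \<int>\<close>.  A submodule is therefore spanned by the kets that it contains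
  (\<open>submodule_is_span_kets\<close>), and is described by a set \<open>K\<close> of integers \<open>k\<close>, one for each
  ket at \<open>m0 + k\<close> in it.  The operator \<open>I32\<close> sends \<open>ket m\<close> to a combination of \<open>ket (m - 1)\<close>
  with coefficient \<open>-1\<close> and \<open>ket (m + 1)\<close> with a coefficient proportional to
  \<open>[l + m + 1] [l - m]\<close>.  Hence \<open>K\<close> is closed under going down, and is left upwards only where this
  product vanishes: \<open>K\<close> is empty, everything, or \<open>{..a}\<close> for a zero \<open>a\<close> of the product
  (\<open>stable_cases\<close>).  As \<open>q\<close> is not a root of unity, each of the two factors has at most one zero, so
  there are at most two such \<open>a\<close> (\<open>coef_zeros\<close>).  The submodules form a chain, and the chain
  itself is a composition series, of length one more than the number of zeros.

  Around this argument stand the facts that make \<open>V\<close> a module over the quotient algebra: the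
  free algebra is a ring that acts associatively (\<open>free_act_mult\<close>), and the two
  defining relations act as zero, by three identities between quantum numbers (\<open>qnum_recurrence\<close>,
  \<open>qnum_quadratic\<close>, \<open>coef_recurrence\<close>).\<close>

section \<open>Submodules and quotients of left modules\<close>

lemma (in left_module) smult_zero_left:
  assumes "x \<in> carrier M"
  shows "\<zero> \<odot>\<^bsub>M\<^esub> x = \<zero>\<^bsub>M\<^esub>"
proof -
  have "\<zero> \<odot>\<^bsub>M\<^esub> x \<oplus>\<^bsub>M\<^esub> \<zero> \<odot>\<^bsub>M\<^esub> x = \<zero> \<odot>\<^bsub>M\<^esub> x"
    using smult_l_distr[of \<zero> \<zero> x] assms by simp
  then show ?thesis
    using assms by (simp add: smult_closed M.add.l_cancel_one')
qed

text \<open>Closure under the scalar \<open>-1\<close> makes closure under additive inverses automatic for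
  submodules.\<close>

lemma (in left_module) smult_minus_one:
  assumes "x \<in> carrier M"
  shows "(\<ominus> \<one>) \<odot>\<^bsub>M\<^esub> x = \<ominus>\<^bsub>M\<^esub> x"
proof -
  have "(\<ominus> \<one>) \<odot>\<^bsub>M\<^esub> x \<oplus>\<^bsub>M\<^esub> x = (\<ominus> \<one> \<oplus> \<one>) \<odot>\<^bsub>M\<^esub> x"
    using assms by (simp add: smult_l_distr smult_one)
  also have "\<dots> = \<zero>\<^bsub>M\<^esub>"
    using assms by (simp add: R.l_neg smult_zero_left)
  finally show ?thesis
    using assms by (simp add: M.minus_equality smult_closed)
qed

lemma (in left_module) left_submoduleI:
  assumes "H \<subseteq> carrier M" and "\<zero>\<^bsub>M\<^esub> \<in> H"
    and "\<And>x y. \<lbrakk>x \<in> H; y \<in> H\<rbrakk> \<Longrightarrow> x \<oplus>\<^bsub>M\<^esub> y \<in> H"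
    and "\<And>a x. \<lbrakk>a \<in> carrier R; x \<in> H\<rbrakk> \<Longrightarrow> a \<odot>\<^bsub>M\<^esub> x \<in> H"
  shows "submodule H R M"
proof -
  have "\<ominus>\<^bsub>M\<^esub> x \<in> H" if "x \<in> H" for x
    using assms(1) assms(4)[of "\<ominus> \<one>" x] that smult_minus_one[of x] by auto
  then show ?thesis
    using assms
    by (intro submodule.intro subgroup.intro submodule_axioms.intro) (auto simp: a_inv_def)
qed

lemma submoduleD:
  assumes "submodule H R M"
  shows "H \<subseteq> carrier M" and "\<zero>\<^bsub>M\<^esub> \<in> H"
    and "\<And>x y. \<lbrakk>x \<in> H; y \<in> H\<rbrakk> \<Longrightarrow> x \<oplus>\<^bsub>M\<^esub> y \<in> H"
    and "\<And>a x. \<lbrakk>a \<in> carrier R; x \<in> H\<rbrakk> \<Longrightarrow> a \<odot>\<^bsub>M\<^esub> x \<in> H"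
    and "\<And>x. x \<in> H \<Longrightarrow> \<ominus>\<^bsub>M\<^esub> x \<in> H"
proof -
  interpret submodule H R M by fact
  show "H \<subseteq> carrier M" and "\<zero>\<^bsub>M\<^esub> \<in> H"
    and "\<And>x y. \<lbrakk>x \<in> H; y \<in> H\<rbrakk> \<Longrightarrow> x \<oplus>\<^bsub>M\<^esub> y \<in> H"
    and "\<And>a x. \<lbrakk>a \<in> carrier R; x \<in> H\<rbrakk> \<Longrightarrow> a \<odot>\<^bsub>M\<^esub> x \<in> H"
    and "\<And>x. x \<in> H \<Longrightarrow> \<ominus>\<^bsub>M\<^esub> x \<in> H"
    using subset one_closed m_closed m_inv_closed smult_closed by (auto simp: a_inv_def)
qed

lemma (in left_module) left_module_submodule:
  assumes "submodule N R M"
  shows "left_module R (M\<lparr>carrier := N\<rparr>)"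
proof -
  note N = submoduleD[OF assms]
  then have Nc: "x \<in> N \<Longrightarrow> x \<in> carrier M" for x
    by auto
  have "\<exists>y\<in>N. y \<oplus>\<^bsub>M\<^esub> x = \<zero>\<^bsub>M\<^esub>" if "x \<in> N" for x
    using N(5)[OF that] M.l_neg[OF Nc[OF that]] by blast
  then have "abelian_group (M\<lparr>carrier := N\<rparr>)"
    using N by (intro abelian_groupI) (auto simp: M.a_ac Nc)
  then show ?thesis
    using N R.ring_axioms
    by (auto intro!: left_module.intro left_module_axioms.intro
        simp: Nc smult_l_distr smult_r_distr smult_assoc1 smult_one)
qed

lemma (in left_module) abelian_subgroup_submodule:
  assumes "submodule N R M"
  shows "abelian_subgroup N M"
  using assms M.abelian_group_axioms
  by (intro abelian_subgroupI3 additive_subgroup.intro) (auto simp: submodule_def)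

text \<open>The union in the definition of the action on a quotient does not depend on the
  representatives: two of them differ by an element of \<open>N\<close>, whose multiples stay in \<open>N\<close>.\<close>

lemma smult_quot_module:
  fixes M :: "('a, 'b) module"
  assumes M: "left_module R M" and N: "submodule N R M" and a: "a \<in> carrier R" and x: "x \<in> carrier M"
  shows "a \<odot>\<^bsub>quot_module M N\<^esub> (N +>\<^bsub>M\<^esub> x) = N +>\<^bsub>M\<^esub> (a \<odot>\<^bsub>M\<^esub> x)"
proof -
  interpret left_module R M
    by fact
  note sub = submoduleD[OF N]
  interpret abelian_subgroup N M
    by (rule abelian_subgroup_submodule[OF N])
  have "N +>\<^bsub>M\<^esub> (a \<odot>\<^bsub>M\<^esub> y) = N +>\<^bsub>M\<^esub> (a \<odot>\<^bsub>M\<^esub> x)" if y: "y \<in> N +>\<^bsub>M\<^esub> x" for y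
  proof -
    obtain n where n: "n \<in> N" "y = n \<oplus>\<^bsub>M\<^esub> x"
      using y by (auto simp: a_r_coset_def')
    have "a \<odot>\<^bsub>M\<^esub> y = a \<odot>\<^bsub>M\<^esub> n \<oplus>\<^bsub>M\<^esub> a \<odot>\<^bsub>M\<^esub> x"
      using n x a sub(1) by (auto simp: smult_r_distr)
    then have "a \<odot>\<^bsub>M\<^esub> y \<in> N +>\<^bsub>M\<^esub> (a \<odot>\<^bsub>M\<^esub> x)"
      using sub(4)[OF a n(1)] by (auto simp: a_r_coset_def')
    then show ?thesis
      using M.a_repr_independence[OF _ _ a_subgroup] smult_closed[OF a x] by metis
  qed
  moreover have "x \<in> N +>\<^bsub>M\<^esub> x"
    by (rule a_rcos_self[OF x])
  ultimately have "(\<Union>y\<in>N +>\<^bsub>M\<^esub> x. N +>\<^bsub>M\<^esub> (a \<odot>\<^bsub>M\<^esub> y)) = N +>\<^bsub>M\<^esub> (a \<odot>\<^bsub>M\<^esub> x)"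
    by blast
  then show ?thesis
    by (simp add: quot_module_def)
qed

lemma left_module_quot_module:
  fixes M :: "('a, 'b) module"
  assumes M: "left_module R M" and N: "submodule N R M"
  shows "left_module R (quot_module M N)"
proof -
  interpret left_module R M
    by fact
  interpret abelian_subgroup N M
    by (rule abelian_subgroup_submodule[OF N])
  have carr: "carrier (quot_module M N) = (+>\<^bsub>M\<^esub>) N ` carrier M"
    by (auto simp: quot_module_def A_RCOSETS_def')
  have add: "(N +>\<^bsub>M\<^esub> x) \<oplus>\<^bsub>quot_module M N\<^esub> (N +>\<^bsub>M\<^esub> y) = N +>\<^bsub>M\<^esub> (x \<oplus>\<^bsub>M\<^esub> y)"
    if "x \<in> carrier M" "y \<in> carrier M" for x y
    using that by (simp add: quot_module_def a_rcos_sum)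
  have zero: "\<zero>\<^bsub>quot_module M N\<^esub> = N +>\<^bsub>M\<^esub> \<zero>\<^bsub>M\<^esub>"
    using a_subset by (simp add: quot_module_def)
  have "\<exists>Y\<in>carrier (quot_module M N). Y \<oplus>\<^bsub>quot_module M N\<^esub> X = \<zero>\<^bsub>quot_module M N\<^esub>"
    if X: "X \<in> carrier (quot_module M N)" for X
  proof -
    obtain x where "x \<in> carrier M" "X = N +>\<^bsub>M\<^esub> x"
      using X carr by auto
    then show ?thesis
      by (intro bexI[of _ "N +>\<^bsub>M\<^esub> (\<ominus>\<^bsub>M\<^esub> x)"]) (auto simp: carr add zero M.l_neg)
  qed
  then have "abelian_group (quot_module M N)"
    by (intro abelian_groupI) (auto simp: carr add zero M.a_ac)
  then show ?thesis
    using R.ring_axioms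
    by (intro left_module.intro left_module_axioms.intro)
      (auto simp: carr add smult_quot_module[OF M N] smult_closed smult_l_distr smult_r_distr smult_assoc1
        smult_one)
qed

text \<open>One half of the correspondence theorem: a submodule of the quotient is determined by its
  preimage, a submodule of \<open>M\<close> that contains \<open>N\<close>.\<close>

lemma simple_quot_moduleI:
  fixes M :: "('a, 'b) module"
  assumes M: "left_module R M" and N: "submodule N R M" and proper: "N \<noteq> carrier M"
    and max: "\<And>H. \<lbrakk>submodule H R M; N \<subseteq> H\<rbrakk> \<Longrightarrow> H = N \<or> H = carrier M"
  shows "simple_module R (quot_module M N)"
proof -
  let ?Q = "quot_module M N"
  interpret left_module R M
    by fact
  interpret abelian_subgroup N M
    by (rule abelian_subgroup_submodule[OF N])
  interpret Q: left_module R ?Q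
    by (rule left_module_quot_module[OF M N])
  note sub = submoduleD[OF N]
  have carr: "carrier ?Q = (+>\<^bsub>M\<^esub>) N ` carrier M"
    by (auto simp: quot_module_def A_RCOSETS_def')
  have zero: "\<zero>\<^bsub>?Q\<^esub> = N"
    by (simp add: quot_module_def)
  have add: "N +>\<^bsub>M\<^esub> (x \<oplus>\<^bsub>M\<^esub> y) = (N +>\<^bsub>M\<^esub> x) \<oplus>\<^bsub>?Q\<^esub> (N +>\<^bsub>M\<^esub> y)"
    if "x \<in> carrier M" "y \<in> carrier M" for x y
    using that by (simp add: quot_module_def a_rcos_sum)
  have in_N: "N +>\<^bsub>M\<^esub> x = N \<longleftrightarrow> x \<in> N" if "x \<in> carrier M" for x
    using that a_rcos_self[of x] a_rcos_const[of x] by auto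
  have "carrier ?Q \<noteq> {\<zero>\<^bsub>?Q\<^esub>}"
  proof -
    obtain x where "x \<in> carrier M" "x \<notin> N"
      using proper sub(1) by auto
    then have "N +>\<^bsub>M\<^esub> x \<in> carrier ?Q" "N +>\<^bsub>M\<^esub> x \<noteq> N"
      using in_N by (auto simp: carr)
    then show ?thesis
      by (auto simp: zero)
  qed
  moreover have "H = {\<zero>\<^bsub>?Q\<^esub>} \<or> H = carrier ?Q" if H: "submodule H R ?Q" for H
  proof -
    note subH = submoduleD[OF H]
    define K where "K = {x \<in> carrier M. N +>\<^bsub>M\<^esub> x \<in> H}"
    have HK: "H = (+>\<^bsub>M\<^esub>) N ` K"
      using subH(1) unfolding K_def carr by auto
    have NK: "N \<subseteq> K"
    proof
      fix x assume x: "x \<in> N"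
      then have "x \<in> carrier M" "N +>\<^bsub>M\<^esub> x = N"
        using sub(1) in_N[of x] by auto
      then show "x \<in> K"
        using subH(2) by (simp add: K_def zero)
    qed
    have "submodule K R M"
    proof (rule left_submoduleI)
      show "K \<subseteq> carrier M"
        by (auto simp: K_def)
      show "\<zero>\<^bsub>M\<^esub> \<in> K"
        using NK sub(2) by auto
      show "x \<oplus>\<^bsub>M\<^esub> y \<in> K" if "x \<in> K" "y \<in> K" for x y
        using that subH(3) by (auto simp: K_def add)
      show "a \<odot>\<^bsub>M\<^esub> x \<in> K" if "a \<in> carrier R" "x \<in> K" for a x
        using that subH(4)[of a "N +>\<^bsub>M\<^esub> x"] smult_quot_module[OF M N, of a x]
        by (auto simp: K_def smult_closed)
    qed
    then consider "K = N" | "K = carrier M"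
      using max NK by blast
    then show ?thesis
    proof cases
      case 1
      then have "N +>\<^bsub>M\<^esub> x = N" if "x \<in> K" for x
        using that in_N[of x] sub(1) by auto
      then have "H = {N}"
        using \<open>K = N\<close> sub(2) unfolding HK by blast
      then show ?thesis
        by (simp add: zero)
    next
      case 2
      then show ?thesis
        by (simp add: HK carr)
    qed
  qed
  ultimately show ?thesis
    using Q.left_module_axioms by (auto simp: simple_module_def)
qed

lemma simple_subquotientI:
  fixes M :: "('a, 'b) module"
  assumes "left_module R M" and N: "submodule N R M" and L: "submodule L R M" and NL: "N \<subset> L"
    and max: "\<And>H. \<lbrakk>submodule H R M; N \<subseteq> H; H \<subseteq> L\<rbrakk> \<Longrightarrow> H = N \<or> H = L"
  shows "simple_module R (quot_module (M\<lparr>carrier := L\<rparr>) N)"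
proof -
  interpret left_module R M
    by fact
  interpret L: left_module R "M\<lparr>carrier := L\<rparr>"
    by (rule left_module_submodule[OF L])
  show ?thesis
  proof (rule simple_quot_moduleI)
    show "left_module R (M\<lparr>carrier := L\<rparr>)" ..
    show "submodule N R (M\<lparr>carrier := L\<rparr>)"
      using submoduleD[OF N] NL by (intro L.left_submoduleI) auto
    show "N \<noteq> carrier (M\<lparr>carrier := L\<rparr>)"
      using NL by auto
    show "H = N \<or> H = carrier (M\<lparr>carrier := L\<rparr>)"
      if H: "submodule H R (M\<lparr>carrier := L\<rparr>)" and NH: "N \<subseteq> H" for H
    proof -
      have "submodule H R M"
        using submoduleD[OF H] submoduleD(1)[OF L] by (intro left_submoduleI) auto
      then show ?thesis
        using max[of H] NH submoduleD(1)[OF H] by auto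
    qed
  qed
qed

section \<open>The free algebra is a ring\<close>

lemma free_algebra_simps:
  "carrier free_algebra = {f. finite {w. f w \<noteq> 0}}"
  "f \<otimes>\<^bsub>free_algebra\<^esub> g = (\<lambda>w. \<Sum>(u, v) \<in> {(u, v). u @ v = w}. f u * g v)"
  "\<one>\<^bsub>free_algebra\<^esub> = word []"
  "\<zero>\<^bsub>free_algebra\<^esub> = (\<lambda>w. 0)"
  "f \<oplus>\<^bsub>free_algebra\<^esub> g = (\<lambda>w. f w + g w)"
  by (simp_all add: free_algebra_def word_def)

text \<open>A word has only finitely many splittings, so the sum that defines the product never falls
  back to the default value \<open>0\<close> of infinite sums.\<close>

lemma finite_splits: "finite {(u, v). u @ v = w}"
proof (rule finite_subset)
  show "{(u, v). u @ v = w} \<subseteq> (\<lambda>k. (take k w, drop k w)) ` {..length w}"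
  proof clarify
    fix u v :: "'a list"
    show "(u, v) \<in> (\<lambda>k. (take k (u @ v), drop k (u @ v))) ` {..length (u @ v)}"
      by (rule image_eqI[of _ _ "length u"]) auto
  qed
qed auto

lemma sum_splits_Nil_left:
  "(\<Sum>(u, v) \<in> {(u, v). u @ v = w}. (if u = [] then F u v else (0::complex))) = F [] w"
proof -
  have "(\<Sum>(u, v) \<in> {(u, v). u @ v = w}. (if u = [] then F u v else 0)) =
    (\<Sum>(u, v) \<in> {([], w)}. (if u = [] then F u v else 0))"
    by (intro sum.mono_neutral_right) (auto simp: finite_splits split: if_splits)
  then show ?thesis by simp
qed

lemma sum_splits_Nil_right:
  "(\<Sum>(u, v) \<in> {(u, v). u @ v = w}. (if v = [] then F u v else (0::complex))) = F w []"
proof -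
  have "(\<Sum>(u, v) \<in> {(u, v). u @ v = w}. (if v = [] then F u v else 0)) =
    (\<Sum>(u, v) \<in> {(w, [])}. (if v = [] then F u v else 0))"
    by (intro sum.mono_neutral_right) (auto simp: finite_splits split: if_splits)
  then show ?thesis by simp
qed

lemma support_free_mult:
  "{w. (f \<otimes>\<^bsub>free_algebra\<^esub> g) w \<noteq> 0} \<subseteq> (\<lambda>(u, v). u @ v) ` ({u. f u \<noteq> 0} \<times> {v. g v \<noteq> 0})"
proof
  fix w assume "w \<in> {w. (f \<otimes>\<^bsub>free_algebra\<^esub> g) w \<noteq> 0}"
  then obtain p where "p \<in> {(u, v). u @ v = w}" "(case p of (u, v) \<Rightarrow> f u * g v) \<noteq> 0"
    unfolding free_algebra_simps by (auto elim: sum.not_neutral_contains_not_neutral)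
  then show "w \<in> (\<lambda>(u, v). u @ v) ` ({u. f u \<noteq> 0} \<times> {v. g v \<noteq> 0})"
    by force
qed

text \<open>Both products are sums over the ways of cutting a word into three pieces; the bijection
  below moves between the two orders of cutting.\<close>

lemma free_mult_assoc:
  "(f \<otimes>\<^bsub>free_algebra\<^esub> g) \<otimes>\<^bsub>free_algebra\<^esub> k = f \<otimes>\<^bsub>free_algebra\<^esub> (g \<otimes>\<^bsub>free_algebra\<^esub> k)"
proof
  fix w
  let ?S = "\<lambda>w. {(u, v). u @ v = (w :: 'a list)}"
  have "((f \<otimes>\<^bsub>free_algebra\<^esub> g) \<otimes>\<^bsub>free_algebra\<^esub> k) w =
      (\<Sum>x\<in>?S w. \<Sum>y\<in>?S (fst x). f (fst y) * g (snd y) * k (snd x))"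
    by (simp add: free_algebra_simps case_prod_beta sum_distrib_right)
  also have "\<dots> = (\<Sum>(x, y)\<in>Sigma (?S w) (\<lambda>x. ?S (fst x)). f (fst y) * g (snd y) * k (snd x))"
    by (rule sum.Sigma) (auto simp: finite_splits)
  also have "\<dots> = (\<Sum>(x, y)\<in>Sigma (?S w) (\<lambda>x. ?S (snd x)). f (fst x) * (g (fst y) * k (snd y)))"
    by (rule sum.reindex_bij_witness[where
          i = "\<lambda>(x, y). ((fst x @ fst y, snd y), (fst x, fst y))" and
          j = "\<lambda>(x, y). ((fst y, snd y @ snd x), (snd y, snd x))"]) auto
  also have "\<dots> = (\<Sum>x\<in>?S w. \<Sum>y\<in>?S (snd x). f (fst x) * (g (fst y) * k (snd y)))"
    by (rule sum.Sigma[symmetric]) (auto simp: finite_splits)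
  also have "\<dots> = (f \<otimes>\<^bsub>free_algebra\<^esub> (g \<otimes>\<^bsub>free_algebra\<^esub> k)) w"
    by (simp add: free_algebra_simps case_prod_beta sum_distrib_left)
  finally show "((f \<otimes>\<^bsub>free_algebra\<^esub> g) \<otimes>\<^bsub>free_algebra\<^esub> k) w = (f \<otimes>\<^bsub>free_algebra\<^esub> (g \<otimes>\<^bsub>free_algebra\<^esub> k)) w" .
qed

lemma finite_support_add:
  fixes f g :: "'a \<Rightarrow> complex"
  assumes "finite {x. f x \<noteq> 0}" "finite {x. g x \<noteq> 0}"
  shows "finite {x. f x + g x \<noteq> 0}"
  by (rule finite_subset[OF _ finite_UnI[OF assms]]) auto

lemma free_mult_closed:
  assumes "f \<in> carrier free_algebra" "g \<in> carrier free_algebra"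
  shows "f \<otimes>\<^bsub>free_algebra\<^esub> g \<in> carrier free_algebra"
  using finite_subset[OF support_free_mult[of f g]] assms by (simp add: free_algebra_simps(1))

lemma word_closed: "word u \<in> carrier free_algebra"
  by (auto simp: free_algebra_simps word_def intro: finite_subset[of _ "{u}"])

lemma ring_free_algebra: "ring (free_algebra :: ('g list \<Rightarrow> complex) ring)"
proof (rule ringI)
  let ?F = "free_algebra :: ('g list \<Rightarrow> complex) ring"
  have "\<exists>g\<in>carrier ?F. g \<oplus>\<^bsub>?F\<^esub> f = \<zero>\<^bsub>?F\<^esub>" if "f \<in> carrier ?F" for f
    using that by (intro bexI[of _ "\<lambda>w. - f w"]) (auto simp: free_algebra_simps)
  then show "abelian_group ?F"
    by (intro abelian_groupI) (auto simp: free_algebra_simps finite_support_add)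
  show "monoid ?F"
  proof (rule monoidI)
    show "\<one>\<^bsub>?F\<^esub> \<otimes>\<^bsub>?F\<^esub> f = f" for f
      using sum_splits_Nil_left[where F = "\<lambda>u v. f v"]
      by (simp add: free_algebra_simps word_def if_distrib if_distribR cong: if_cong)
    show "f \<otimes>\<^bsub>?F\<^esub> \<one>\<^bsub>?F\<^esub> = f" for f
      using sum_splits_Nil_right[where F = "\<lambda>u v. f u"]
      by (simp add: free_algebra_simps word_def if_distrib if_distribR cong: if_cong)
  qed (use word_closed in \<open>auto simp: free_mult_closed free_mult_assoc free_algebra_simps(3)\<close>)
qed (simp_all add: free_algebra_simps case_prod_beta distrib_left distrib_right sum.distrib)

section \<open>The action of the free algebra\<close>

text \<open>The zeros of the coefficient of \<open>ket (m + 1)\<close> in \<open>I32\<close> applied to \<open>ket m\<close> decide which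
  submodules exist.\<close>

definition coef :: "complex \<Rightarrow> complex \<Rightarrow> complex \<Rightarrow> complex" where
  "coef h l m = qnum h (l + m + 1) * qnum h (l - m)
     / ((qpow h m + qpow h (- m)) * (qpow h (m + 1) + qpow h (- m - 1)))"

text \<open>Evaluated at a point, the operators become pointwise multiplication and weighted shifts, from
  which linearity and the relations can be read off.  This needs finite support, because on other
  vectors the defining sum is \<open>0\<close> by default.\<close>

lemma gen_op_I21:
  assumes "finite {m. v m \<noteq> 0}"
  shows "gen_op h l I21 v = (\<lambda>x. \<i> * qnum h x * v x)"
proof
  fix x
  have "gen_op h l I21 v x = (\<Sum>m | v m \<noteq> 0. if m = x then \<i> * qnum h x * v x else 0)"
    unfolding gen_op_def by (intro sum.cong) (auto simp: ket_def)
  then show "gen_op h l I21 v x = \<i> * qnum h x * v x"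
    using assms by simp
qed

lemma gen_op_I32:
  assumes "finite {m. v m \<noteq> 0}"
  shows "gen_op h l I32 v = (\<lambda>x. coef h l (x - 1) * v (x - 1) - v (x + 1))"
proof
  fix x
  have "gen_op h l I32 v x =
    (\<Sum>m | v m \<noteq> 0. (if m = x - 1 then coef h l (x - 1) * v (x - 1) else 0)
      - (if m = x + 1 then v (x + 1) else 0))"
    unfolding gen_op_def
    by (intro sum.cong) (auto simp: ket_def coef_def algebra_simps)
  also have "\<dots> = coef h l (x - 1) * v (x - 1) - v (x + 1)"
    using assms by (simp add: sum_subtractf)
  finally show "gen_op h l I32 v x = coef h l (x - 1) * v (x - 1) - v (x + 1)" .
qed

lemma finite_support_gen_op:
  assumes "finite {m. v m \<noteq> 0}"
  shows "finite {m. gen_op h l g v m \<noteq> 0}"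
proof (cases g)
  case I21
  then show ?thesis
    using assms by (auto simp: gen_op_I21 intro: finite_subset[of _ "{m. v m \<noteq> 0}"])
next
  case I32
  have "{m. gen_op h l g v m \<noteq> 0} \<subseteq> (\<lambda>m. m + 1) ` {m. v m \<noteq> 0} \<union> (\<lambda>m. m - 1) ` {m. v m \<noteq> 0}"
    using assms by (auto simp: I32 gen_op_I32 image_iff)
      (metis add_diff_cancel diff_add_cancel mult_zero_right diff_self)+
  then show ?thesis
    using assms finite_subset by blast
qed

lemma finite_support_foldr:
  assumes "finite {m. v m \<noteq> 0}"
  shows "finite {m. foldr (gen_op h l) w v m \<noteq> 0}"
  by (induction w) (auto simp: assms finite_support_gen_op)

lemma finite_support_lincomb:
  fixes c :: "'i \<Rightarrow> complex" and v :: "'i \<Rightarrow> 'a \<Rightarrow> complex"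
  assumes "finite S" "\<And>s. s \<in> S \<Longrightarrow> finite {m. v s m \<noteq> 0}"
  shows "finite {m. (\<Sum>s\<in>S. c s * v s m) \<noteq> 0}"
proof (rule finite_subset)
  show "{m. (\<Sum>s\<in>S. c s * v s m) \<noteq> 0} \<subseteq> (\<Union>s\<in>S. {m. v s m \<noteq> 0})"
    by (auto intro!: sum.neutral)
qed (use assms in auto)

lemma gen_op_lincomb:
  assumes "finite S" "\<And>s. s \<in> S \<Longrightarrow> finite {m. v s m \<noteq> 0}"
  shows "gen_op h l g (\<lambda>x. \<Sum>s\<in>S. c s * v s x) = (\<lambda>x. \<Sum>s\<in>S. c s * gen_op h l g (v s) x)"
  using assms finite_support_lincomb[OF assms, where c = c]
  by (cases g)
    (simp_all add: gen_op_I21 gen_op_I32 sum_distrib_left sum_subtractf right_diff_distrib mult_ac)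

lemma foldr_gen_op_lincomb:
  assumes "finite S" "\<And>s. s \<in> S \<Longrightarrow> finite {m. v s m \<noteq> 0}"
  shows "foldr (gen_op h l) w (\<lambda>x. \<Sum>s\<in>S. c s * v s x) =
    (\<lambda>x. \<Sum>s\<in>S. c s * foldr (gen_op h l) w (v s) x)"
  by (induction w) (simp_all add: gen_op_lincomb assms finite_support_foldr)

text \<open>Summing over a common finite set of words lets the actions of several elements be compared
  term by term.\<close>

lemma free_act_superset:
  assumes "finite S" "{w. f w \<noteq> 0} \<subseteq> S"
  shows "free_act h l f v = (\<lambda>x. \<Sum>w\<in>S. f w * foldr (gen_op h l) w v x)"
  unfolding free_act_def using assms by (intro ext sum.mono_neutral_left) auto

lemma free_act_add:
  assumes "finite {w. f w \<noteq> 0}" "finite {w. g w \<noteq> 0}"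
  shows "free_act h l (\<lambda>w. f w + g w) v = (\<lambda>x. free_act h l f v x + free_act h l g v x)"
proof -
  let ?S = "{w. f w \<noteq> 0} \<union> {w. g w \<noteq> 0}"
  have S: "finite ?S"
    using assms by simp
  show ?thesis
    by (subst (1 2 3) free_act_superset[OF S]) (auto simp: sum.distrib algebra_simps)
qed

lemma free_act_vec_add:
  assumes "finite {m. v m \<noteq> 0}" "finite {m. u m \<noteq> 0}"
  shows "free_act h l f (\<lambda>x. v x + u x) = (\<lambda>x. free_act h l f v x + free_act h l f u x)"
proof -
  have "foldr (gen_op h l) w (\<lambda>x. v x + u x) =
      (\<lambda>x. foldr (gen_op h l) w v x + foldr (gen_op h l) w u x)" for w
    using foldr_gen_op_lincomb[of "UNIV :: bool set" "\<lambda>b. if b then v else u" h l w "\<lambda>_. 1"] assms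
    by (simp add: UNIV_bool add.commute)
  then show ?thesis
    by (simp add: free_act_def algebra_simps sum.distrib)
qed

text \<open>The words \<open>a @ b\<close> with \<open>a\<close> and \<open>b\<close> in the two supports carry the product, and a concatenated word
  acts by composition, so grouping the pairs \<open>(a, b)\<close> by \<open>a @ b\<close> turns one sum into the other.\<close>

lemma free_act_mult:
  assumes f: "finite {w. f w \<noteq> 0}" and g: "finite {w. g w \<noteq> 0}" and v: "finite {m. v m \<noteq> 0}"
  shows "free_act h l (f \<otimes>\<^bsub>free_algebra\<^esub> g) v = free_act h l f (free_act h l g v)"
proof
  fix x
  let ?F = "{w. f w \<noteq> 0}" and ?G = "{w. g w \<noteq> 0}" and ?T = "foldr (gen_op h l)"
  let ?S = "(\<lambda>(u, v). u @ v) ` (?F \<times> ?G)"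
  have fg: "(f \<otimes>\<^bsub>free_algebra\<^esub> g) w =
      (\<Sum>p | p \<in> ?F \<times> ?G \<and> (case p of (a, b) \<Rightarrow> a @ b) = w. f (fst p) * g (snd p))"
    for w
    unfolding free_algebra_simps case_prod_beta
    by (intro sum.mono_neutral_right) (use finite_splits[of w] in \<open>auto simp: case_prod_beta'\<close>)
  have S: "finite ?S"
    using f g by auto
  have "free_act h l (f \<otimes>\<^bsub>free_algebra\<^esub> g) v x = (\<Sum>w\<in>?S. (f \<otimes>\<^bsub>free_algebra\<^esub> g) w * ?T w v x)"
    using free_act_superset[OF S support_free_mult] by simp
  also have "\<dots> = (\<Sum>w\<in>?S. \<Sum>p | p \<in> ?F \<times> ?G \<and> (case p of (a, b) \<Rightarrow> a @ b) = w.
      f (fst p) * g (snd p) * ?T (fst p @ snd p) v x)"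
    unfolding fg sum_distrib_right by (intro sum.cong) auto
  also have "\<dots> = (\<Sum>p\<in>?F \<times> ?G. f (fst p) * g (snd p) * ?T (fst p @ snd p) v x)"
    by (rule sum.group) (use f g S in auto)
  also have "\<dots> = (\<Sum>a\<in>?F. f a * (\<Sum>b\<in>?G. g b * ?T a (?T b v) x))"
    by (simp add: sum.cartesian_product' sum_distrib_left mult.assoc)
  also have "\<dots> = free_act h l f (free_act h l g v) x"
    unfolding free_act_def
    by (subst foldr_gen_op_lincomb) (auto simp: g v finite_support_foldr)
  finally show "free_act h l (f \<otimes>\<^bsub>free_algebra\<^esub> g) v x = free_act h l f (free_act h l g v) x" .
qed

lemma free_act_smult_word:
  "free_act h l (\<lambda>w. c * word u w) v = (\<lambda>x. c * foldr (gen_op h l) u v x)"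
  by (subst free_act_superset[of "{u}"]) (auto simp: word_def)

section \<open>Identities between quantum numbers\<close>

lemma qpow_add: "qpow h (a + b) = qpow h a * qpow h b"
  by (simp add: qpow_def distrib_left exp_add)

lemma qpow_minus: "qpow h (- a) = inverse (qpow h a)"
  by (simp add: qpow_def exp_minus)

lemma qpow_diff: "qpow h (a - b) = qpow h a * inverse (qpow h b)"
  by (metis diff_conv_add_uminus qpow_add qpow_minus)

lemma qpow_nonzero: "qpow h a \<noteq> 0"
  by (simp add: qpow_def)

lemma qpow_two: "qpow h 2 = qpow h 1 * qpow h 1"
  using qpow_add[of h 1 1] by simp

text \<open>The period of the exponential function, in the form in which it contradicts
  \<open>h\<close> not being a rational multiple of \<open>2 \<pi> \<i>\<close>.\<close>

lemma exp_eq_1_imp: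
  fixes z :: complex
  assumes "exp z = 1"
  obtains n :: int where "z = 2 * of_real pi * \<i> * of_int n"
proof -
  have "exp (Re z) = 1"
    using arg_cong[OF assms, of norm] by simp
  then have re: "Re z = 0"
    by simp
  then have "cos (Im z) = 1"
    using arg_cong[OF assms, of Re] by (simp add: Re_exp)
  then obtain n :: int where "Im z = of_int n * 2 * pi"
    using cos_one_2pi_int by auto
  then have "z = 2 * of_real pi * \<i> * of_int n"
    using re by (simp add: complex_eq_iff)
  then show ?thesis
    by (rule that)
qed

locale so3_rep =
  fixes h l m0 :: complex
  assumes h: "h \<notin> {2 * of_real pi * \<i> * r | r. r \<in> \<rat>}"
    and m0: "\<forall>k::int. qpow h (2 * m0 + of_int k) \<noteq> -1"
begin

text \<open>The condition on \<open>h\<close> says that \<open>q\<close> is not a root of unity, and enters only in this form.\<close>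

lemma qpow_int_eq_1:
  assumes "qpow h (of_int k) = 1"
  shows "k = 0"
proof (rule ccontr)
  assume k: "k \<noteq> 0"
  obtain n :: int where "h * of_int k = 2 * of_real pi * \<i> * of_int n"
    using assms exp_eq_1_imp[of "h * of_int k"] by (auto simp: qpow_def)
  then have "h = 2 * of_real pi * \<i> * (of_int n / of_int k)"
    using k by (simp add: field_simps)
  moreover have "(of_int n / of_int k :: complex) \<in> \<rat>"
    by simp
  ultimately show False
    using h by blast
qed

lemma q_denominator_nonzero: "qpow h 1 - qpow h (- 1) \<noteq> 0"
proof
  assume "qpow h 1 - qpow h (- 1) = 0"
  then have "qpow h (of_int 2) = 1"
    using qpow_nonzero[of h 1] by (simp add: qpow_two qpow_minus field_simps)
  from qpow_int_eq_1[OF this] show False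
    by simp
qed

text \<open>If the sum vanished at \<open>m\<close>, then \<open>q\<close> to the power \<open>2 m\<close> would be \<open>-1\<close>, and
  \<open>2 m\<close> lies in \<open>2 m0 + \<int>\<close>.  So no denominator in the action of \<open>I32\<close> on the
  representation is zero.\<close>

lemma qpow_sum_nonzero: "qpow h (m0 + of_int k) + qpow h (- (m0 + of_int k)) \<noteq> 0"
proof
  let ?m = "m0 + of_int k"
  assume "qpow h ?m + qpow h (- ?m) = 0"
  then have "qpow h ?m * qpow h ?m = - 1"
    using qpow_nonzero[of h ?m] unfolding qpow_minus by (simp add: field_simps eq_neg_iff_add_eq_0)
  then have "qpow h (2 * m0 + of_int (2 * k)) = - 1"
    using qpow_add[of h ?m ?m] by (simp add: algebra_simps)
  then show False
    using m0 by blast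
qed

text \<open>Once the quantum numbers are written over their common denominator, the identities between
  them become polynomial identities in powers of \<open>q\<close>, modulo \<open>q\<^sup>a q\<^sup>-\<^sup>a = 1\<close>.\<close>

lemma qnum_expansions:
  defines "d \<equiv> qpow h 1 - qpow h (- 1)"
  shows "d \<noteq> 0" "qpow h a * qpow h (- a) = 1"
    "qnum h a = (qpow h a - qpow h (- a)) / d"
    "qnum h 2 = qpow h 1 + qpow h (- 1)"
    "qnum h (a + b) = (qpow h a * qpow h b - qpow h (- a) * qpow h (- b)) / d"
    "qnum h (a - b) = (qpow h a * qpow h (- b) - qpow h (- a) * qpow h b) / d"
    "qnum h (a + b + 1) =
      (qpow h a * qpow h b * qpow h 1 - qpow h (- a) * qpow h (- b) * qpow h (- 1)) / d"
    "qnum h (a - b + 1) =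
      (qpow h a * qpow h (- b) * qpow h 1 - qpow h (- a) * qpow h b * qpow h (- 1)) / d"
proof -
  show d: "d \<noteq> 0"
    using q_denominator_nonzero by (simp add: d_def)
  show "qnum h a = (qpow h a - qpow h (- a)) / d"
    by (simp add: qnum_def d_def)
  show "qnum h (a + b) = (qpow h a * qpow h b - qpow h (- a) * qpow h (- b)) / d" for a b
    using qpow_add[of h "- a" "- b"] by (simp add: qnum_def d_def qpow_add)
  from this[of a "- b"]
  show "qnum h (a - b) = (qpow h a * qpow h (- b) - qpow h (- a) * qpow h b) / d"
    by simp
  show sum: "qnum h (a + b + 1) =
      (qpow h a * qpow h b * qpow h 1 - qpow h (- a) * qpow h (- b) * qpow h (- 1)) / d" for a b
    using qpow_add[of h "- a" "- b"] qpow_add[of h "- a - b" "- 1"]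
    by (simp add: qnum_def d_def qpow_add)
  from this[of a "- b"]
  show "qnum h (a - b + 1) =
      (qpow h a * qpow h (- b) * qpow h 1 - qpow h (- a) * qpow h b * qpow h (- 1)) / d"
    by simp
  show inv: "qpow h a * qpow h (- a) = 1" for a
    using qpow_add[of h a "- a"] by (simp add: qpow_def)
  have "qnum h 2 = (qpow h 1 * qpow h 1 - qpow h (- 1) * qpow h (- 1)) / d"
    using qpow_add[of h 1 1] qpow_add[of h "- 1" "- 1"] by (simp add: qnum_def d_def)
  also have "\<dots> = (qpow h 1 + qpow h (- 1)) * d / d"
    by (simp add: d_def algebra_simps)
  finally show "qnum h 2 = qpow h 1 + qpow h (- 1)"
    using d by simp
qed

text \<open>This kills the coefficients of \<open>ket (m + 2)\<close> and \<open>ket (m - 2)\<close> in the first relation.\<close>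

lemma qnum_recurrence: "qnum h (m + 1) + qnum h (m - 1) = qnum h 2 * qnum h m"
proof -
  have "(p * s - P * S) / d + (p * S - P * s) / d = (s + S) * ((p - P) / d)"
    for p P s S d :: complex
    by (simp add: add_divide_distrib[symmetric] algebra_simps)
  then show ?thesis
    unfolding qnum_expansions(4) qnum_expansions(3)[of m] qnum_expansions(5)[of m]
      qnum_expansions(6)[of m] .
qed

lemma qnum_diff_two: "qnum h (m + 1) - qnum h (m - 1) = qpow h m + qpow h (- m)"
proof -
  have "(p * s - P * S) / (s - S) - (p * S - P * s) / (s - S) = p + P" if "s - S \<noteq> 0"
    for p P s S :: complex
  proof -
    have "(p * s - P * S) / (s - S) - (p * S - P * s) / (s - S) = (p + P) * (s - S) / (s - S)"
      unfolding diff_divide_distrib[symmetric] by (simp add: algebra_simps)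
    then show ?thesis
      using that by simp
  qed
  from this[OF qnum_expansions(1)] show ?thesis
    unfolding qnum_expansions(5)[of m] qnum_expansions(6)[of m] .
qed

text \<open>The second relation amounts to this identity between neighbouring eigenvalues of \<open>I21\<close>.  The
  recurrence reduces it to \<open>[m]\<^sup>2 - [m + 1] [m - 1] = 1\<close>.\<close>

lemma qnum_quadratic:
  "(qnum h (m + 1))\<^sup>2 - qnum h 2 * qnum h m * qnum h (m + 1) + (qnum h m)\<^sup>2 = 1"
proof -
  have "((p - P) / d)\<^sup>2 - (p * s - P * S) / d * ((p * S - P * s) / d) = 1"
    if "d = s - S" "d \<noteq> 0" "s * S = 1" "p * P = 1" for p P s S d :: complex
  proof -
    have "(p - P)\<^sup>2 - (p * s - P * S) * (p * S - P * s) = (s - S)\<^sup>2"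
    proof -
      have "(p - P)\<^sup>2 - (p * s - P * S) * (p * S - P * s) =
          (p * p + P * P) * (1 - s * S) + (s * s + S * S) * (p * P - 1) - 2 * (p * P) + 2 * (s * S)
          + (s - S)\<^sup>2"
        by (simp add: algebra_simps power2_eq_square)
      then show ?thesis
        by (simp add: that(3,4))
    qed
    moreover have "((p - P) / d)\<^sup>2 - (p * s - P * S) / d * ((p * S - P * s) / d) =
      ((p - P)\<^sup>2 - (p * s - P * S) * (p * S - P * s)) / d\<^sup>2"
      by (simp add: diff_divide_distrib[symmetric] power_divide power2_eq_square)
    ultimately show ?thesis
      using that(1,2) by simp
  qed
  from this[OF refl qnum_expansions(1) qnum_expansions(2) qnum_expansions(2)[of m]]
  have "(qnum h m)\<^sup>2 - qnum h (m + 1) * qnum h (m - 1) = 1"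
    unfolding qnum_expansions(3)[of m] qnum_expansions(5)[of m] qnum_expansions(6)[of m] .
  moreover have "(qnum h (m + 1))\<^sup>2 - qnum h 2 * qnum h m * qnum h (m + 1) =
      - (qnum h (m + 1) * qnum h (m - 1))"
    unfolding qnum_recurrence[of m, symmetric] by (simp add: algebra_simps power2_eq_square)
  ultimately show ?thesis
    by simp
qed

lemma qnum_product_difference:
  "qnum h (l + m + 1) * qnum h (l - m) - qnum h (l + m) * qnum h (l - m + 1) =
    - (qnum h m * (qpow h m + qpow h (- m)))"
proof -
  have "(r * p * s - R * P * S) / d * ((r * P - R * p) / d)
      - (r * p - R * P) / d * ((r * P * s - R * p * S) / d) = - ((p - P) / d * (p + P))"
    if "d = s - S" "d \<noteq> 0" "r * R = 1" for p P s S r R d :: complex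
  proof -
    have "(r * p * s - R * P * S) * (r * P - R * p) - (r * p - R * P) * (r * P * s - R * p * S) =
      - ((p - P) * (p + P) * (s - S))"
    proof -
      have "(r * p * s - R * P * S) * (r * P - R * p) - (r * p - R * P) * (r * P * s - R * p * S) =
          (r * R) * (- ((p - P) * (p + P) * (s - S)))"
        by (simp add: algebra_simps)
      then show ?thesis
        by (simp add: that(3))
    qed
    then have "(r * p * s - R * P * S) / d * ((r * P - R * p) / d)
      - (r * p - R * P) / d * ((r * P * s - R * p * S) / d) = - ((p - P) * (p + P) * d) / (d * d)"
      using that(1) by (simp add: diff_divide_distrib[symmetric])
    also have "\<dots> = - ((p - P) / d * (p + P))"
      using that(2) by simp
    finally show ?thesis .
  qed
  from this[OF refl qnum_expansions(1) qnum_expansions(2)[of l]]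
  show ?thesis
    unfolding qnum_expansions(3)[of m] qnum_expansions(5)[of l m] qnum_expansions(6)[of l m]
      qnum_expansions(7)[of l m] qnum_expansions(8)[of l m] .
qed

text \<open>The coefficient of \<open>ket m\<close> in the first relation applied to \<open>ket m\<close>.  Each difference of quantum
  numbers cancels one factor in the denominator of its coefficient; the other factor,
  \<open>q\<^sup>m + q\<^sup>-\<^sup>m\<close>, is common to both terms and is cancelled by \<open>qnum_product_difference\<close>.\<close>

lemma coef_recurrence:
  assumes "m = m0 + of_int k"
  shows "coef h l m * (qnum h (m + 2) - qnum h m) + coef h l (m - 1) * (qnum h (m - 2) - qnum h m)
    = - qnum h m"
proof -
  let ?S = "\<lambda>m. qpow h m + qpow h (- m)"
  have S: "?S m \<noteq> 0" "?S (m + 1) \<noteq> 0" "?S (m - 1) \<noteq> 0"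
    using qpow_sum_nonzero[of k] qpow_sum_nonzero[of "k + 1"] qpow_sum_nonzero[of "k - 1"]
    by (simp_all add: assms algebra_simps)
  have "coef h l m = qnum h (l + m + 1) * qnum h (l - m) / (?S m * ?S (m + 1))"
    by (simp add: coef_def)
  moreover have "qnum h (m + 2) - qnum h m = ?S (m + 1)"
    using qnum_diff_two[of "m + 1"] by (simp add: add.assoc)
  ultimately have "coef h l m * (qnum h (m + 2) - qnum h m) =
      qnum h (l + m + 1) * qnum h (l - m) / ?S m"
    using S by simp
  moreover have "coef h l (m - 1) * (qnum h (m - 2) - qnum h m)
      = - (qnum h (l + m) * qnum h (l - m + 1) / ?S m)"
  proof -
    have "qnum h m - qnum h (m - 2) = ?S (m - 1)"
      using qnum_diff_two[of "m - 1"] by simp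
    then have "qnum h (m - 2) - qnum h m = - ?S (m - 1)"
      by (metis minus_diff_eq)
    moreover have "coef h l (m - 1) = qnum h (l + m) * qnum h (l - m + 1) / (?S (m - 1) * ?S m)"
    proof -
      have "l + (m - 1) + 1 = l + m" "l - (m - 1) = l - m + 1" "m - 1 + 1 = m"
        "- (m - 1) - 1 = - m"
        by simp_all
      then show ?thesis
        unfolding coef_def by presburger
    qed
    moreover have "a / (u * w) * (- u) = - (a / w)" if "u \<noteq> 0" for a u w :: complex
      using that by simp
    ultimately show ?thesis
      using S(3) by (simp only:)
  qed
  ultimately have "coef h l m * (qnum h (m + 2) - qnum h m)
      + coef h l (m - 1) * (qnum h (m - 2) - qnum h m) =
      (qnum h (l + m + 1) * qnum h (l - m) - qnum h (l + m) * qnum h (l - m + 1)) / ?S m"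
    by (simp add: diff_divide_distrib)
  also have "\<dots> = - qnum h m"
    using S(1) unfolding qnum_product_difference by simp
  finally show ?thesis .
qed

end

section \<open>The representation is a module\<close>

definition span_kets :: "complex \<Rightarrow> int set \<Rightarrow> (complex \<Rightarrow> complex) set" where
  "span_kets m0 K = {v. finite {m. v m \<noteq> 0} \<and> {m. v m \<noteq> 0} \<subseteq> (\<lambda>k. m0 + of_int k) ` K}"

lemma carrier_Vrep: "carrier (Vrep h l m0) = span_kets m0 UNIV"
proof -
  have "{m0 + n | n. n \<in> \<int>} = range (\<lambda>k. m0 + of_int k)"
    by (auto simp: Ints_def)
  then show ?thesis
    by (simp add: Vrep_def span_kets_def)
qed

lemma Vrep_simps:
  "\<zero>\<^bsub>Vrep h l m0\<^esub> = (\<lambda>_. 0)"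
  "v \<oplus>\<^bsub>Vrep h l m0\<^esub> w = (\<lambda>x. v x + w x)"
  "u \<odot>\<^bsub>Vrep h l m0\<^esub> v = the_elem ((\<lambda>f. free_act h l f v) ` u)"
  by (simp_all add: Vrep_def)

lemma span_kets_zero: "(\<lambda>_. 0) \<in> span_kets m0 K"
  by (simp add: span_kets_def)

lemma span_kets_add:
  "v \<in> span_kets m0 K \<Longrightarrow> w \<in> span_kets m0 K \<Longrightarrow> (\<lambda>x. v x + w x) \<in> span_kets m0 K"
  using finite_support_add[of v w] unfolding span_kets_def by (force simp: subset_iff)

lemma span_kets_smult: "v \<in> span_kets m0 K \<Longrightarrow> (\<lambda>x. c * v x) \<in> span_kets m0 K"
  unfolding span_kets_def by (auto intro: finite_subset[of _ "{m. v m \<noteq> 0}"])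

lemma span_kets_lincomb:
  assumes "finite S" "\<And>s. s \<in> S \<Longrightarrow> v s \<in> span_kets m0 K"
  shows "(\<lambda>x. \<Sum>s\<in>S. c s * v s x) \<in> span_kets m0 K"
  using assms by (induction S) (auto simp: span_kets_zero intro!: span_kets_add span_kets_smult)

lemma span_kets_support: "v \<in> span_kets m0 K \<Longrightarrow> finite {m. v m \<noteq> 0}"
  by (simp add: span_kets_def)

lemma span_kets_mono: "K \<subseteq> L \<Longrightarrow> span_kets m0 K \<subseteq> span_kets m0 L"
  unfolding span_kets_def by blast

lemma ket_in_span_kets: "k \<in> K \<Longrightarrow> ket (m0 + of_int k) \<in> span_kets m0 K"
  by (auto simp: span_kets_def ket_def)

lemma ket_in_span_kets_iff: "ket (m0 + of_int k) \<in> span_kets m0 K \<longleftrightarrow> k \<in> K"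
  by (auto simp: span_kets_def ket_def)

text \<open>The stable sets are those whose kets span a subspace invariant under both generators.  The first
  condition is unconditional because \<open>ket (m - 1)\<close> always occurs in \<open>I32\<close> applied to \<open>ket m\<close>.\<close>

definition stable :: "complex \<Rightarrow> complex \<Rightarrow> complex \<Rightarrow> int set \<Rightarrow> bool" where
  "stable h l m0 K \<longleftrightarrow>
    (\<forall>k\<in>K. k - 1 \<in> K \<and> (coef h l (m0 + of_int k) \<noteq> 0 \<longrightarrow> k + 1 \<in> K))"

lemma stable_UNIV: "stable h l m0 UNIV"
  by (simp add: stable_def)

lemma gen_op_span_kets:
  assumes K: "stable h l m0 K" and v: "v \<in> span_kets m0 K"
  shows "gen_op h l g v \<in> span_kets m0 K"
proof -
  have fin: "finite {m. v m \<noteq> 0}"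
    using v by (simp add: span_kets_def)
  have supp: "x \<in> (\<lambda>k. m0 + of_int k) ` K" if "v x \<noteq> 0" for x
    using v that by (auto simp: span_kets_def)
  have "x \<in> (\<lambda>k. m0 + of_int k) ` K" if x: "gen_op h l g v x \<noteq> 0" for x
  proof (cases g)
    case I21
    then show ?thesis
      using x supp by (simp add: gen_op_I21[OF fin])
  next
    case I32
    then consider "coef h l (x - 1) \<noteq> 0" "v (x - 1) \<noteq> 0" | "v (x + 1) \<noteq> 0"
      using x by (fastforce simp: gen_op_I32[OF fin])
    then show ?thesis
    proof cases
      case 1
      then obtain k where k: "k \<in> K" "x - 1 = m0 + of_int k"
        using supp[of "x - 1"] by auto
      then have "k + 1 \<in> K"
        using K 1(1) by (auto simp: stable_def)
      then show ?thesis
        using k(2) by (intro image_eqI[of _ _ "k + 1"]) (auto simp: algebra_simps)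
    next
      case 2
      then obtain k where k: "k \<in> K" "x + 1 = m0 + of_int k"
        using supp[of "x + 1"] by auto
      then have "k - 1 \<in> K"
        using K by (auto simp: stable_def)
      then show ?thesis
        using k(2) by (intro image_eqI[of _ _ "k - 1"]) (auto simp: algebra_simps)
    qed
  qed
  then show ?thesis
    using finite_support_gen_op[OF fin] by (auto simp: span_kets_def)
qed

lemma free_act_span_kets:
  assumes "stable h l m0 K" "v \<in> span_kets m0 K" "finite {w. f w \<noteq> 0}"
  shows "free_act h l f v \<in> span_kets m0 K"
proof -
  have "foldr (gen_op h l) w v \<in> span_kets m0 K" for w
    by (induction w) (auto simp: assms gen_op_span_kets)
  then show ?thesis
    unfolding free_act_def using assms(3) by (intro span_kets_lincomb)
qed

lemma so3_relations_subset: "so3_relations h \<subseteq> carrier free_algebra"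
proof -
  have "(\<lambda>w. word a w - c * word b w + word d w + word e w) \<in> carrier free_algebra"
    for a b d e :: "gen list" and c
  proof -
    have "{w. word a w - c * word b w + word d w + word e w \<noteq> 0} \<subseteq> {a, b, d, e}"
      by (auto simp: word_def)
    then have "finite {w. word a w - c * word b w + word d w + word e w \<noteq> 0}"
      by (rule finite_subset) simp
    then show ?thesis
      by (simp add: free_algebra_simps(1))
  qed
  then show ?thesis
    by (simp add: so3_relations_def)
qed

text \<open>The relations have degree three, so values are needed for up to three nested operators.  Each
  equation evaluates only the outermost operator, whose argument is known to have finite support.\<close>

lemma gen_op_at:
  assumes "v \<in> span_kets m0 UNIV"
  shows "gen_op h l I21 v x = \<i> * qnum h x * v x"
    "gen_op h l I32 v x = coef h l (x - 1) * v (x - 1) - v (x + 1)"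
    "gen_op h l I21 (gen_op h l g v) x = \<i> * qnum h x * gen_op h l g v x"
    "gen_op h l I32 (gen_op h l g v) x =
      coef h l (x - 1) * gen_op h l g v (x - 1) - gen_op h l g v (x + 1)"
    "gen_op h l I21 (gen_op h l g (gen_op h l g' v)) x =
      \<i> * qnum h x * gen_op h l g (gen_op h l g' v) x"
    "gen_op h l I32 (gen_op h l g (gen_op h l g' v)) x =
      coef h l (x - 1) * gen_op h l g (gen_op h l g' v) (x - 1)
        - gen_op h l g (gen_op h l g' v) (x + 1)"
  using span_kets_support[OF assms]
    finite_support_gen_op[OF span_kets_support[OF assms]]
    finite_support_gen_op[OF finite_support_gen_op[OF span_kets_support[OF assms]]]
  by (simp_all only: gen_op_I21 gen_op_I32)

context so3_rep
begin

text \<open>At a point outside \<open>m0 + \<int>\<close> the denominators may vanish and \<open>coef_recurrence\<close> may fail,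
  but there all the values that enter the relations are zero.\<close>

lemma off_lattice:
  assumes "v \<in> span_kets m0 UNIV" "x \<notin> range (\<lambda>k. m0 + of_int k)"
  shows "v (x + of_int j) = 0"
proof (rule ccontr)
  assume "v (x + of_int j) \<noteq> 0"
  then obtain k where "x + of_int j = m0 + of_int k"
    using assms(1) by (auto simp: span_kets_def)
  then have "x = m0 + of_int (k - j)"
    by (simp add: algebra_simps)
  then show False
    using assms(2) by blast
qed

text \<open>The value at \<open>x\<close> involves \<open>v (x - 2)\<close>, \<open>v x\<close> and \<open>v (x + 2)\<close>.  The outer coefficients vanish by
  \<open>qnum_recurrence\<close>, the middle one by \<open>coef_recurrence\<close>.\<close>

lemma relation_1_acts_as_zero:
  assumes v: "v \<in> span_kets m0 UNIV"
  shows "gen_op h l I32 (gen_op h l I32 (gen_op h l I21 v)) x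
     - qnum h 2 * gen_op h l I32 (gen_op h l I21 (gen_op h l I32 v)) x
     + gen_op h l I21 (gen_op h l I32 (gen_op h l I32 v)) x + gen_op h l I21 v x = 0"
proof (cases "x \<in> range (\<lambda>k. m0 + of_int k)")
  case False
  then have z: "v x = 0" "v (x + 2) = 0" "v (x - 2) = 0"
    using off_lattice[OF v False, of 0] off_lattice[OF v False, of 2]
      off_lattice[OF v False, of "-2"] by simp_all
  have eqs: "x - 1 - 1 = x - 2" "x + 1 + 1 = x + 2" "x - 1 + 1 = x" "x + 1 - 1 = x"
    by simp_all
  show ?thesis
    by (simp add: gen_op_at[OF v] z eqs)
next
  case True
  then obtain k where k: "x = m0 + of_int k"
    by blast
  have eqs: "x - 1 - 1 = x - 2" "x + 1 + 1 = x + 2" "x - 1 + 1 = x" "x + 1 - 1 = x"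
    by simp_all
  have r1: "qnum h (x + 2) = qnum h 2 * qnum h (x + 1) - qnum h x"
    using qnum_recurrence[of "x + 1"] by (simp add: eqs eq_diff_eq)
  have r2: "qnum h (x - 2) = qnum h 2 * qnum h (x - 1) - qnum h x"
    using qnum_recurrence[of "x - 1"] by (simp add: eqs algebra_simps)
  note c = coef_recurrence[OF k]
  let ?L = "gen_op h l I32 (gen_op h l I32 (gen_op h l I21 v)) x
     - qnum h 2 * gen_op h l I32 (gen_op h l I21 (gen_op h l I32 v)) x
     + gen_op h l I21 (gen_op h l I32 (gen_op h l I32 v)) x + gen_op h l I21 v x"
  have "?L = \<i> * (coef h l (x - 1) * coef h l (x - 2) * v (x - 2)
        * (qnum h (x - 2) - (qnum h 2 * qnum h (x - 1) - qnum h x))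
      + v (x + 2) * (qnum h (x + 2) - (qnum h 2 * qnum h (x + 1) - qnum h x))
      + v x * (coef h l x * ((qnum h 2 * qnum h (x + 1) - qnum h x) - qnum h x)
        + coef h l (x - 1) * ((qnum h 2 * qnum h (x - 1) - qnum h x) - qnum h x) + qnum h x))"
    by (simp add: gen_op_at[OF v] eqs)
      (simp add: algebra_simps)
  also have "\<dots> = 0"
    unfolding r1[symmetric] r2[symmetric] c by simp
  finally show ?thesis .
qed

text \<open>Only \<open>v (x - 1)\<close> and \<open>v (x + 1)\<close> occur, since \<open>I32\<close> is applied once; both coefficients vanish by
  \<open>qnum_quadratic\<close>.\<close>

lemma relation_2_acts_as_zero:
  assumes v: "v \<in> span_kets m0 UNIV"
  shows "gen_op h l I21 (gen_op h l I21 (gen_op h l I32 v)) x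
     - qnum h 2 * gen_op h l I21 (gen_op h l I32 (gen_op h l I21 v)) x
     + gen_op h l I32 (gen_op h l I21 (gen_op h l I21 v)) x + gen_op h l I32 v x = 0"
proof -
  let ?L = "gen_op h l I21 (gen_op h l I21 (gen_op h l I32 v)) x
     - qnum h 2 * gen_op h l I21 (gen_op h l I32 (gen_op h l I21 v)) x
     + gen_op h l I32 (gen_op h l I21 (gen_op h l I21 v)) x + gen_op h l I32 v x"
  let ?q = "\<lambda>a b. a\<^sup>2 - qnum h 2 * b * a + b\<^sup>2"
  have ii: "\<i> * (\<i> * z) = - z" for z
    by (simp add: mult.assoc[symmetric])
  have "?L = coef h l (x - 1) * v (x - 1) * (1 - ?q (qnum h x) (qnum h (x - 1)))
      - v (x + 1) * (1 - ?q (qnum h (x + 1)) (qnum h x))"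
    by (simp add: gen_op_at[OF v])
      (simp add: algebra_simps power2_eq_square ii)
  also have "\<dots> = 0"
    using qnum_quadratic[of x] qnum_quadratic[of "x - 1"] by simp
  finally show ?thesis .
qed

lemma free_act_relation:
  assumes r: "r \<in> so3_relations h" and v: "v \<in> span_kets m0 UNIV"
  shows "free_act h l r v = (\<lambda>_. 0)"
proof -
  have act: "free_act h l (\<lambda>w. word a w - c * word b w + word d w + word e w) v =
    (\<lambda>x. foldr (gen_op h l) a v x - c * foldr (gen_op h l) b v x
      + foldr (gen_op h l) d v x + foldr (gen_op h l) e v x)"
    if "distinct [a, b, d, e]" for a b d e :: "gen list" and c
    using that by (subst free_act_superset[of "{a, b, d, e}"]) (auto simp: word_def)
  from r show ?thesis
    unfolding so3_relations_def
    using relation_1_acts_as_zero[OF v] relation_2_acts_as_zero[OF v]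
    by (auto simp: act)
qed

definition annihilator :: "(gen list \<Rightarrow> complex) set" where
  "annihilator = {f \<in> carrier free_algebra. \<forall>v\<in>span_kets m0 UNIV. free_act h l f v = (\<lambda>_. 0)}"

lemma free_act_zero_vec: "free_act h l f (\<lambda>_. 0) = (\<lambda>_. 0)"
proof -
  have "foldr (gen_op h l) w (\<lambda>_. 0) = (\<lambda>_. 0)" for w
    by (induction w) (simp_all add: gen_op_def)
  then show ?thesis
    by (simp add: free_act_def)
qed

lemma free_act_uminus: "free_act h l (\<lambda>w. - f w) v = (\<lambda>x. - free_act h l f v x)"
  by (simp add: free_act_def sum_negf)

text \<open>The annihilator is a two-sided ideal because the action is multiplicative and preserves the
  representation space.  Since it contains the relations, it contains the ideal that they generate,
  and the action descends to the quotient.\<close>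

lemma ideal_annihilator: "ideal annihilator free_algebra"
proof -
  let ?F = "free_algebra :: (gen list \<Rightarrow> complex) ring"
  interpret F: ring ?F
    by (rule ring_free_algebra)
  show ?thesis
  proof (rule idealI)
    show "ring ?F" ..
    have "\<ominus>\<^bsub>?F\<^esub> f = (\<lambda>w. - f w)" if "f \<in> carrier ?F" for f
      using that by (intro F.minus_equality) (auto simp: free_algebra_simps)
    then have "\<ominus>\<^bsub>?F\<^esub> f \<in> annihilator" if "f \<in> annihilator" for f
      using that F.a_inv_closed[of f] by (auto simp: annihilator_def free_act_uminus)
    then show "subgroup annihilator (add_monoid ?F)"
      by (intro subgroup.intro)
        (auto simp: annihilator_def free_algebra_simps a_inv_def free_act_add finite_support_add
          free_act_def[of _ _ "\<lambda>_. 0"])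
    fix f g assume f: "f \<in> annihilator" and g: "g \<in> carrier ?F"
    then have fin: "finite {w. f w \<noteq> 0}" "finite {w. g w \<noteq> 0}"
      by (auto simp: annihilator_def free_algebra_simps(1))
    have "f \<in> carrier ?F"
      using f by (simp add: annihilator_def)
    then show "g \<otimes>\<^bsub>?F\<^esub> f \<in> annihilator" "f \<otimes>\<^bsub>?F\<^esub> g \<in> annihilator"
      using f g fin free_act_span_kets[OF stable_UNIV]
      by (auto simp: annihilator_def free_act_mult span_kets_support free_act_zero_vec)
  qed
qed

abbreviation relation_ideal where
  "relation_ideal \<equiv> Idl\<^bsub>free_algebra\<^esub> (so3_relations h)"

lemma ideal_relation_ideal: "ideal relation_ideal free_algebra"
  by (rule ring.genideal_ideal[OF ring_free_algebra so3_relations_subset])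

lemma relation_ideal_annihilates:
  assumes "r \<in> relation_ideal" "v \<in> span_kets m0 UNIV"
  shows "free_act h l r v = (\<lambda>_. 0)"
proof -
  have "relation_ideal \<subseteq> annihilator"
    using so3_relations_subset free_act_relation
    by (intro ring.genideal_minimal[OF ring_free_algebra ideal_annihilator])
      (auto simp: annihilator_def)
  then show ?thesis
    using assms by (auto simp: annihilator_def)
qed

abbreviation coset :: "(gen list \<Rightarrow> complex) \<Rightarrow> (gen list \<Rightarrow> complex) set" where
  "coset f \<equiv> relation_ideal +>\<^bsub>free_algebra\<^esub> f"

lemma carrier_Uq: "carrier (Uq_tw_so3 h) = coset ` carrier free_algebra"
  by (auto simp: Uq_tw_so3_def FactRing_def A_RCOSETS_def')

lemma coset_hom:
  assumes "f \<in> carrier free_algebra" "g \<in> carrier free_algebra"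
  shows "coset f \<oplus>\<^bsub>Uq_tw_so3 h\<^esub> coset g = coset (f \<oplus>\<^bsub>free_algebra\<^esub> g)"
    and "coset f \<otimes>\<^bsub>Uq_tw_so3 h\<^esub> coset g = coset (f \<otimes>\<^bsub>free_algebra\<^esub> g)"
  using ring_hom_add[OF ideal.rcos_ring_hom[OF ideal_relation_ideal] assms]
    ring_hom_mult[OF ideal.rcos_ring_hom[OF ideal_relation_ideal] assms]
  by (simp_all add: Uq_tw_so3_def)

lemma coset_one: "\<one>\<^bsub>Uq_tw_so3 h\<^esub> = coset (word [])"
  by (simp add: Uq_tw_so3_def FactRing_def free_algebra_simps(3))

text \<open>All representatives of a coset act alike, so the image in the definition of the action is a
  singleton.\<close>

lemma coset_smult:
  assumes f: "f \<in> carrier free_algebra" and v: "v \<in> span_kets m0 UNIV"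
  shows "coset f \<odot>\<^bsub>Vrep h l m0\<^esub> v = free_act h l f v"
proof -
  interpret I: ideal relation_ideal free_algebra
    by (rule ideal_relation_ideal)
  have "free_act h l g v = free_act h l f v" if g: "g \<in> coset f" for g
  proof -
    obtain r where r: "r \<in> relation_ideal" "g = r \<oplus>\<^bsub>free_algebra\<^esub> f"
      using g by (auto simp: a_r_coset_def')
    then show ?thesis
      using relation_ideal_annihilates[OF r(1) v] I.Icarr[OF r(1)] f
      by (simp add: free_algebra_simps free_act_add)
  qed
  moreover have "f \<in> coset f"
    by (rule I.a_rcos_self[OF f])
  ultimately have "(\<lambda>g. free_act h l g v) ` coset f = {free_act h l f v}"
    by blast
  then show ?thesis
    by (simp add: Vrep_simps)
qed

lemma left_module_Vrep: "left_module (Uq_tw_so3 h) (Vrep h l m0)"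
proof (intro left_module.intro left_module_axioms.intro)
  let ?R = "Uq_tw_so3 h" and ?M = "Vrep h l m0"
  let ?F = "free_algebra :: (gen list \<Rightarrow> complex) ring"
  interpret F: ring ?F
    by (rule ring_free_algebra)
  have fin: "finite {w. f w \<noteq> 0}" if "f \<in> carrier ?F" for f
    using that by (simp add: free_algebra_simps)
  have closed: "free_act h l f v \<in> span_kets m0 UNIV"
    if "f \<in> carrier ?F" "v \<in> span_kets m0 UNIV" for f v
    using free_act_span_kets[OF stable_UNIV that(2) fin[OF that(1)]] .
  show "ring ?R"
    unfolding Uq_tw_so3_def by (rule ideal.quotient_is_ring[OF ideal_relation_ideal])
  have "\<exists>w\<in>span_kets m0 UNIV. (\<lambda>x. w x + v x) = (\<lambda>_. 0)" if "v \<in> span_kets m0 UNIV" for v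
    using span_kets_smult[OF that, of "-1"] by (intro bexI[of _ "\<lambda>x. - v x"]) auto
  then show "abelian_group ?M"
    by (intro abelian_groupI)
      (auto simp: carrier_Vrep Vrep_simps span_kets_add span_kets_zero add_ac)
  show "a \<odot>\<^bsub>?M\<^esub> x \<in> carrier ?M" if "a \<in> carrier ?R" "x \<in> carrier ?M" for a x
    using that by (auto simp: carrier_Uq carrier_Vrep coset_smult closed)
  show "(a \<oplus>\<^bsub>?R\<^esub> b) \<odot>\<^bsub>?M\<^esub> x = a \<odot>\<^bsub>?M\<^esub> x \<oplus>\<^bsub>?M\<^esub> b \<odot>\<^bsub>?M\<^esub> x"
    if ab: "a \<in> carrier ?R" "b \<in> carrier ?R" and x: "x \<in> carrier ?M" for a b x
  proof -
    obtain f g where fg: "f \<in> carrier ?F" "a = coset f" "g \<in> carrier ?F" "b = coset g"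
      using ab by (auto simp: carrier_Uq)
    have "free_act h l (f \<oplus>\<^bsub>?F\<^esub> g) x = free_act h l f x \<oplus>\<^bsub>?M\<^esub> free_act h l g x"
      using fg fin by (simp add: free_algebra_simps(5) Vrep_simps free_act_add)
    then show ?thesis
      using fg x by (simp add: carrier_Vrep coset_hom coset_smult)
  qed
  show "a \<odot>\<^bsub>?M\<^esub> (x \<oplus>\<^bsub>?M\<^esub> y) = a \<odot>\<^bsub>?M\<^esub> x \<oplus>\<^bsub>?M\<^esub> a \<odot>\<^bsub>?M\<^esub> y"
    if "a \<in> carrier ?R" "x \<in> carrier ?M" "y \<in> carrier ?M" for a x y
    using that span_kets_add[of x m0 UNIV y]
    by (auto simp: carrier_Uq carrier_Vrep coset_smult Vrep_simps(2) free_act_vec_add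
        span_kets_support)
  show "(a \<otimes>\<^bsub>?R\<^esub> b) \<odot>\<^bsub>?M\<^esub> x = a \<odot>\<^bsub>?M\<^esub> (b \<odot>\<^bsub>?M\<^esub> x)"
    if ab: "a \<in> carrier ?R" "b \<in> carrier ?R" and x: "x \<in> carrier ?M" for a b x
  proof -
    obtain f g where fg: "f \<in> carrier ?F" "a = coset f" "g \<in> carrier ?F" "b = coset g"
      using ab by (auto simp: carrier_Uq)
    then show ?thesis
      using x fin
      by (simp add: carrier_Vrep coset_hom coset_smult closed free_act_mult span_kets_support)
  qed
  show "\<one>\<^bsub>?R\<^esub> \<odot>\<^bsub>?M\<^esub> x = x" if "x \<in> carrier ?M" for x
    using that coset_one free_act_smult_word[of h l 1 "[]" x]
    by (simp add: carrier_Vrep coset_smult word_closed)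
qed

end

section \<open>Submodules and the composition series\<close>

context so3_rep
begin

abbreviation Uq where "Uq \<equiv> Uq_tw_so3 h"
abbreviation V where "V \<equiv> Vrep h l m0"

sublocale V: left_module Uq V
  by (rule left_module_Vrep)

lemma submodule_span_kets:
  assumes "stable h l m0 K"
  shows "submodule (span_kets m0 K) Uq V"
proof (rule V.left_submoduleI)
  have sub: "span_kets m0 K \<subseteq> span_kets m0 UNIV"
    by (rule span_kets_mono) simp
  then show "span_kets m0 K \<subseteq> carrier V"
    by (simp add: carrier_Vrep)
  show "\<zero>\<^bsub>V\<^esub> \<in> span_kets m0 K"
    by (simp add: Vrep_simps span_kets_zero)
  show "v \<oplus>\<^bsub>V\<^esub> w \<in> span_kets m0 K" if "v \<in> span_kets m0 K" "w \<in> span_kets m0 K" for v w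
    using that by (simp add: Vrep_simps span_kets_add)
  show "a \<odot>\<^bsub>V\<^esub> v \<in> span_kets m0 K" if "a \<in> carrier Uq" "v \<in> span_kets m0 K" for a v
  proof -
    obtain f where f: "f \<in> carrier free_algebra" "a = coset f"
      using \<open>a \<in> carrier Uq\<close> by (auto simp: carrier_Uq)
    then have "finite {w. f w \<noteq> 0}"
      by (simp add: free_algebra_simps(1))
    moreover have "a \<odot>\<^bsub>V\<^esub> v = free_act h l f v"
      using f that(2) sub by (auto simp: coset_smult)
    ultimately show ?thesis
      using free_act_span_kets[OF assms that(2)] by simp
  qed
qed

text \<open>Scalar multiples of words give the scalars and the generators as elements of the algebra, so a
  submodule is a subspace that is invariant under both generators.\<close>

lemma submodule_closed:
  assumes H: "submodule H Uq V"
  shows "H \<subseteq> span_kets m0 UNIV" and "(\<lambda>_. 0) \<in> H"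
    and "\<And>v w. v \<in> H \<Longrightarrow> w \<in> H \<Longrightarrow> (\<lambda>x. v x + w x) \<in> H"
    and "\<And>c v. v \<in> H \<Longrightarrow> (\<lambda>x. c * v x) \<in> H"
    and "\<And>g v. v \<in> H \<Longrightarrow> gen_op h l g v \<in> H"
proof -
  show sub: "H \<subseteq> span_kets m0 UNIV"
    using submoduleD(1)[OF H] by (simp add: carrier_Vrep)
  show "(\<lambda>_. 0) \<in> H"
    using submoduleD(2)[OF H] by (simp add: Vrep_simps)
  show "(\<lambda>x. v x + w x) \<in> H" if "v \<in> H" "w \<in> H" for v w
    using submoduleD(3)[OF H that] by (simp add: Vrep_simps)
  have act: "(\<lambda>x. c * foldr (gen_op h l) u v x) \<in> H" if v: "v \<in> H" for c u v
  proof -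
    have "(\<lambda>w. c * word u w) \<in> carrier free_algebra"
      by (auto simp: free_algebra_simps(1) word_def intro: finite_subset[of _ "{u}"])
    then have "coset (\<lambda>w. c * word u w) \<odot>\<^bsub>V\<^esub> v \<in> H"
      "coset (\<lambda>w. c * word u w) \<odot>\<^bsub>V\<^esub> v = (\<lambda>x. c * foldr (gen_op h l) u v x)"
      using submoduleD(4)[OF H _ v] v sub by (auto simp: carrier_Uq coset_smult free_act_smult_word)
    then show ?thesis
      by simp
  qed
  show "(\<lambda>x. c * v x) \<in> H" if "v \<in> H" for c v
    using act[OF that, of c "[]"] by simp
  show "gen_op h l g v \<in> H" if "v \<in> H" for g v
    using act[OF that, of 1 "[g]"] by simp
qed

text \<open>With \<open>p = q\<^sup>m\<close> and \<open>r = q\<^sup>m'\<close>, the equation \<open>p - 1 / p = r - 1 / r\<close> factors as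
  \<open>(p - r) (p r + 1) = 0\<close>, and the second factor is nonzero by the condition on \<open>m0\<close>.\<close>

lemma qnum_inj:
  assumes "qnum h (m0 + of_int j) = qnum h (m0 + of_int k)"
  shows "j = k"
proof -
  let ?p = "qpow h (m0 + of_int j)" and ?r = "qpow h (m0 + of_int k)"
  have "?p - inverse ?p = ?r - inverse ?r"
    using assms q_denominator_nonzero unfolding qnum_def qpow_minus by simp
  then have "(?p - ?r) * (?p * ?r + 1) = 0"
    using qpow_nonzero[of h "m0 + of_int j"] qpow_nonzero[of h "m0 + of_int k"]
    by (simp add: field_simps)
  moreover have "?p * ?r = qpow h (2 * m0 + of_int (j + k))"
    unfolding qpow_add[symmetric] by (simp add: algebra_simps)
  then have "?p * ?r + 1 \<noteq> 0"
    using m0 by (metis add_eq_0_iff2)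
  ultimately have "?p = ?r"
    by simp
  then have "qpow h (of_int (j - k)) = 1"
    using qpow_nonzero[of h "m0 + of_int k"] qpow_diff[of h "m0 + of_int j" "m0 + of_int k"] by simp
  from qpow_int_eq_1[OF this] show ?thesis
    by simp
qed

text \<open>Eigenvectors for different eigenvalues can be separated: if \<open>v\<close> has a further ket at \<open>m0 + j\<close> in
  its support, applying \<open>I21 - \<i> [m0 + j]\<close> removes that ket, keeps the one at \<open>m0 + k\<close>, and enlarges
  the support nowhere.\<close>

lemma ket_in_submodule:
  assumes H: "submodule H Uq V" and "v \<in> H" and "v (m0 + of_int k) \<noteq> 0"
  shows "ket (m0 + of_int k) \<in> H"
  using assms(2,3)
proof (induction "card {x. v x \<noteq> 0}" arbitrary: v rule: less_induct)
  case less
  note sub = submodule_closed[OF H]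
  let ?m = "m0 + of_int k"
  have v: "v \<in> span_kets m0 UNIV"
    using less.prems(1) sub(1) by auto
  show ?case
  proof (cases "\<exists>x. x \<noteq> ?m \<and> v x \<noteq> 0")
    case False
    then have "ket ?m = (\<lambda>x. inverse (v ?m) * v x)"
      using less.prems(2) by (intro ext) (auto simp: ket_def)
    then show ?thesis
      using sub(4)[OF less.prems(1), of "inverse (v ?m)"] by simp
  next
    case True
    then obtain j where j: "j \<noteq> k" "v (m0 + of_int j) \<noteq> 0"
      using v by (auto simp: span_kets_def)
    define w where "w = (\<lambda>x. gen_op h l I21 v x + (- (\<i> * qnum h (m0 + of_int j))) * v x)"
    have w_eq: "w x = \<i> * (qnum h x - qnum h (m0 + of_int j)) * v x" for x
      by (simp add: w_def gen_op_at[OF v] algebra_simps)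
    have "w \<in> H"
      unfolding w_def using sub(3)[OF sub(5) sub(4)] less.prems(1) by blast
    moreover have "w ?m \<noteq> 0"
      using qnum_inj[of k j] j(1) less.prems(2) by (auto simp: w_eq)
    moreover have "card {x. w x \<noteq> 0} < card {x. v x \<noteq> 0}"
    proof (rule psubset_card_mono)
      show "finite {x. v x \<noteq> 0}"
        using v by (rule span_kets_support)
      have "{x. w x \<noteq> 0} \<subseteq> {x. v x \<noteq> 0} - {m0 + of_int j}"
        by (auto simp: w_eq)
      then show "{x. w x \<noteq> 0} \<subset> {x. v x \<noteq> 0}"
        using j(2) by blast
    qed
    ultimately show ?thesis
      using less.hyps by blast
  qed
qed

lemma submodule_is_span_kets:
  assumes H: "submodule H Uq V"
  obtains K where "stable h l m0 K" "H = span_kets m0 K"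
proof
  note sub = submodule_closed[OF H]
  define K where "K = {k. ket (m0 + of_int k) \<in> H}"
  show "stable h l m0 K"
    unfolding stable_def
  proof (intro ballI conjI impI)
    fix k assume k: "k \<in> K"
    let ?m = "m0 + of_int k"
    let ?w = "gen_op h l I32 (ket ?m)"
    have w: "?w \<in> H" "?w x = coef h l (x - 1) * ket ?m (x - 1) - ket ?m (x + 1)" for x
      using k sub(5) gen_op_at(2)[OF ket_in_span_kets[of k UNIV]] by (auto simp: K_def)
    have "?w (m0 + of_int (k - 1)) \<noteq> 0"
      unfolding w(2) by (simp add: ket_def)
    then show "k - 1 \<in> K"
      unfolding K_def mem_Collect_eq by (rule ket_in_submodule[OF H w(1)])
    assume c: "coef h l ?m \<noteq> 0"
    have "?w (m0 + of_int (k + 1)) = coef h l ?m"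
      unfolding w(2) by (simp add: ket_def add.assoc[symmetric])
    then show "k + 1 \<in> K"
      using ket_in_submodule[OF H w(1), of "k + 1"] c by (simp add: K_def)
  qed
  show "H = span_kets m0 K"
  proof
    show "H \<subseteq> span_kets m0 K"
    proof
      fix v assume v: "v \<in> H"
      then have "v \<in> span_kets m0 UNIV"
        using sub(1) by auto
      then show "v \<in> span_kets m0 K"
        using ket_in_submodule[OF H v] unfolding span_kets_def K_def by blast
    qed
    show "span_kets m0 K \<subseteq> H"
    proof
      fix v assume v: "v \<in> span_kets m0 K"
      have comb: "(\<lambda>x. \<Sum>m\<in>S. v m * ket m x) \<in> H" if "finite S" "S \<subseteq> {m. v m \<noteq> 0}" for S
        using that
      proof (induction S)
        case (insert m S)
        then have "ket m \<in> H"
          using v by (auto simp: span_kets_def K_def)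
        then show ?case
          using insert sub(3)[OF sub(4)] by simp
      qed (simp add: sub(2))
      have "v = (\<lambda>x. \<Sum>m | v m \<noteq> 0. v m * ket m x)"
        using span_kets_support[OF v] by (auto simp: ket_def if_distrib cong: if_cong)
      then show "v \<in> H"
        using comb[OF span_kets_support[OF v] subset_refl] by simp
    qed
  qed
qed

lemma span_kets_subset_iff: "span_kets m0 K \<subseteq> span_kets m0 L \<longleftrightarrow> K \<subseteq> L"
  using span_kets_mono ket_in_span_kets ket_in_span_kets_iff by (metis subset_iff)

text \<open>A stable set is closed downwards.  Unless it is empty or everything it has a largest element
  \<open>a\<close>, and \<open>a + 1\<close> is missing only if the coefficient at \<open>a\<close> vanishes.\<close>

lemma stable_cases:
  assumes "stable h l m0 K"
  obtains "K = {}" | "K = UNIV" | a where "coef h l (m0 + of_int a) = 0" "K = {..a}"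
proof (cases "K = {} \<or> K = UNIV")
  case True
  then show ?thesis
    using that by blast
next
  case False
  have down: "j \<in> K" if "k \<in> K" "j \<le> k" for j k
    using that(2,1)
  proof (induction rule: int_le_induct)
    case (step i)
    then show ?case
      using assms by (auto simp: stable_def)
  qed
  obtain k b where k: "k \<in> K" and b: "b \<notin> K"
    using False by blast
  \<comment> \<open>The largest element, reached from \<open>k\<close> upwards.\<close>
  define a where "a = k + int (GREATEST n. k + int n \<in> K)"
  have bound: "n \<le> nat (b - k)" if "k + int n \<in> K" for n
    using down[OF that, of b] b by linarith
  have a: "a \<in> K"
    unfolding a_def using k bound by (intro GreatestI_nat[where P = "\<lambda>n. k + int n \<in> K" and k = 0]) auto
  have "a + 1 \<notin> K"
  proof
    assume "a + 1 \<in> K"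
    then have "k + int (Suc (GREATEST n. k + int n \<in> K)) \<in> K"
      by (simp add: a_def algebra_simps)
    then have "Suc (GREATEST n. k + int n \<in> K) \<le> (GREATEST n. k + int n \<in> K)"
      using bound by (rule Greatest_le_nat)
    then show False
      by simp
  qed
  then have "coef h l (m0 + of_int a) = 0"
    using a assms by (auto simp: stable_def)
  moreover have "K = {..a}"
    using down[OF a] down[of _ "a + 1"] \<open>a + 1 \<notin> K\<close> by force
  ultimately show ?thesis
    using that by blast
qed

lemma stable_atMost: "coef h l (m0 + of_int a) = 0 \<Longrightarrow> stable h l m0 {..a}"
  by (force simp: stable_def order.order_iff_strict)

lemma stable_empty: "stable h l m0 {}"
  by (simp add: stable_def)

text \<open>Spans of kets translate inclusions of stable sets into inclusions of submodules, so a maximal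
  chain of stable sets is a composition series.\<close>

lemma has_length_stable_chain:
  assumes "K 0 = {}" "K n = UNIV" "\<And>j. j \<le> n \<Longrightarrow> stable h l m0 (K j)"
    and proper: "\<And>j. j < n \<Longrightarrow> K j \<subset> K (Suc j)"
    and maximal: "\<And>j L. j < n \<Longrightarrow> stable h l m0 L \<Longrightarrow> K j \<subseteq> L \<Longrightarrow> L \<subseteq> K (Suc j) \<Longrightarrow>
      L = K j \<or> L = K (Suc j)"
  shows "has_length Uq V n"
  unfolding has_length_def composition_series_def
proof (intro conjI exI allI impI)
  show "left_module Uq V" ..
  show "span_kets m0 (K 0) = {\<zero>\<^bsub>V\<^esub>}"
    using span_kets_zero by (auto simp: assms(1) span_kets_def Vrep_simps)
  show "span_kets m0 (K n) = carrier V"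
    by (simp add: assms(2) carrier_Vrep)
  show "submodule (span_kets m0 (K j)) Uq V" if "j \<le> n" for j
    using submodule_span_kets assms(3) that by blast
  fix j assume j: "j < n"
  show "span_kets m0 (K j) \<subseteq> span_kets m0 (K (Suc j))"
    using proper[OF j] by (intro span_kets_mono) auto
  show "simple_module Uq (quot_module (V\<lparr>carrier := span_kets m0 (K (Suc j))\<rparr>) (span_kets m0 (K j)))"
  proof (rule simple_subquotientI)
    show "left_module Uq V" ..
    show "submodule (span_kets m0 (K j)) Uq V" "submodule (span_kets m0 (K (Suc j))) Uq V"
      using submodule_span_kets assms(3)[of j] assms(3)[of "Suc j"] j by auto
    show "span_kets m0 (K j) \<subset> span_kets m0 (K (Suc j))"
      using proper[OF j] by (simp add: less_le_not_le span_kets_subset_iff)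
    fix H assume H: "submodule H Uq V" "span_kets m0 (K j) \<subseteq> H" "H \<subseteq> span_kets m0 (K (Suc j))"
    obtain L where L: "stable h l m0 L" "H = span_kets m0 L"
      using submodule_is_span_kets[OF H(1)] .
    then show "H = span_kets m0 (K j) \<or> H = span_kets m0 (K (Suc j))"
      using maximal[OF j L(1)] H(2,3) by (auto simp: span_kets_subset_iff)
  qed
qed

text \<open>A zero of \<open>[m]\<close> means that \<open>q\<^sup>m\<close> has square \<open>1\<close>; two zeros in the same coset of \<open>\<int>\<close> would make an
  even power of \<open>q\<close> equal to \<open>1\<close>.\<close>

lemma qnum_zero_unique:
  assumes "qnum h (b + of_int j) = 0" "qnum h (b + of_int k) = 0"
  shows "j = k"
proof -
  have sq: "qpow h (b + of_int i) * qpow h (b + of_int i) = 1" if "qnum h (b + of_int i) = 0" for i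
  proof -
    have "qpow h (b + of_int i) = qpow h (- (b + of_int i))"
      using that q_denominator_nonzero by (simp add: qnum_def)
    then show ?thesis
      using qnum_expansions(2)[of "b + of_int i"] by simp
  qed
  have "qpow h (of_int (2 * (j - k))) * (qpow h (b + of_int k) * qpow h (b + of_int k)) =
      qpow h (b + of_int j) * qpow h (b + of_int j)"
    unfolding qpow_add[symmetric] by (simp add: algebra_simps)
  then have "qpow h (of_int (2 * (j - k))) = 1"
    using sq assms by simp
  from qpow_int_eq_1[OF this] show ?thesis
    by simp
qed

text \<open>Since the denominator is nonzero, a zero of the coefficient is a zero of one of the two factors
  \<open>[l + m + 1]\<close> and \<open>[l - m]\<close>, and each of these has at most one zero.\<close>

lemma coef_zeros:
  defines "Z \<equiv> {k. coef h l (m0 + of_int k) = 0}"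
  shows "finite Z" "card Z \<le> 2"
proof -
  have "qnum h (l + m0 + 1 + of_int k) = 0 \<or> qnum h (l - m0 + of_int (- k)) = 0" if "k \<in> Z" for k
  proof -
    have "m0 + of_int (k + 1) = m0 + of_int k + 1"
      "- (m0 + of_int (k + 1)) = - (m0 + of_int k) - 1"
      by simp_all
    then have "qpow h (m0 + of_int k + 1) + qpow h (- (m0 + of_int k) - 1) \<noteq> 0"
      using qpow_sum_nonzero[of "k + 1"] by metis
    then have "qnum h (l + (m0 + of_int k) + 1) = 0 \<or> qnum h (l - (m0 + of_int k)) = 0"
      using that qpow_sum_nonzero[of k] unfolding Z_def coef_def by auto
    moreover have "l + (m0 + of_int k) + 1 = l + m0 + 1 + of_int k"
      "l - (m0 + of_int k) = l - m0 + of_int (- k)"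
      by simp_all
    ultimately show ?thesis
      by metis
  qed
  moreover obtain i where "\<And>k. qnum h (l + m0 + 1 + of_int k) = 0 \<Longrightarrow> k = i"
    using qnum_zero_unique by metis
  moreover obtain j where "\<And>k. qnum h (l - m0 + of_int (- k)) = 0 \<Longrightarrow> k = j"
    using qnum_zero_unique by (metis neg_equal_iff_equal)
  ultimately have sub: "Z \<subseteq> {i, j}"
    by blast
  then show "finite Z"
    by (rule finite_subset) simp
  have "card Z \<le> card {i, j}"
    using sub by (intro card_mono) simp_all
  also have "\<dots> \<le> 2"
    by (simp add: card_insert_if)
  finally show "card Z \<le> 2" .
qed

text \<open>The zeros of the coefficient in increasing order, \<open>a 0 < \<dots> < a (p - 1)\<close>, give the chain of all
  stable sets: empty, \<open>{..a 0}\<close> up to \<open>{..a (p - 1)}\<close>, and everything.\<close>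

lemma length_at_most_3: "\<exists>n\<le>3. has_length Uq V n"
proof -
  define Z where "Z = {k. coef h l (m0 + of_int k) = 0}"
  define p where "p = card Z"
  define a where "a = (\<lambda>j. sorted_list_of_set Z ! j)"
  have Z: "finite Z" "p \<le> 2"
    using coef_zeros by (simp_all add: Z_def p_def)
  have a_Z: "Z = a ` {..<p}"
  proof -
    have "Z = set (sorted_list_of_set Z)"
      using Z by simp
    also have "\<dots> = a ` {..<p}"
      unfolding a_def p_def set_conv_nth by auto
    finally show ?thesis .
  qed
  have a_less: "a i < a j" if "i < j" "j < p" for i j
    using strict_sorted_list_of_set[of Z] that by (auto simp: a_def p_def sorted_wrt_iff_nth_less)
  have a_le: "i \<le> j" if "a i \<le> a j" "i < p" for i j
    using a_less[of j i] that by linarith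
  define K where "K = (\<lambda>j. if j = 0 then {} else if j \<le> p then {..a (j - 1)} else UNIV)"
  have "has_length Uq V (p + 1)"
  proof (rule has_length_stable_chain[where K = K])
    show "K 0 = {}" "K (p + 1) = UNIV"
      by (simp_all add: K_def)
    show "stable h l m0 (K j)" for j
    proof -
      have "coef h l (m0 + of_int (a (j - 1))) = 0" if "0 < j" "j \<le> p"
        using a_Z that by (auto simp: Z_def)
      then show ?thesis
        by (auto simp: K_def stable_empty stable_UNIV intro!: stable_atMost)
    qed
    show "K j \<subset> K (Suc j)" if "j < p + 1" for j
    proof (cases j)
      case 0
      then show ?thesis
        by (auto simp: K_def)
    next
      case (Suc i)
      show ?thesis
      proof (cases "j < p")
        case True
        then have "a i < a j"
          using Suc a_less by simp
        then show ?thesis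
          using Suc True by (auto simp: K_def)
      next
        case False
        have "a i + 1 \<notin> {..a i}"
          by simp
        then have "{..a i} \<noteq> UNIV"
          by blast
        then show ?thesis
          using that Suc False by (auto simp: K_def)
      qed
    qed
    fix j L assume j: "j < p + 1" and L: "stable h l m0 L" "K j \<subseteq> L" "L \<subseteq> K (Suc j)"
    from L(1) show "L = K j \<or> L = K (Suc j)"
    proof (cases rule: stable_cases)
      case 1
      then show ?thesis
        using L(2) by auto
    next
      case 2
      then show ?thesis
        using L(3) by auto
    next
      case (3 b)
      then obtain i where i: "i < p" "b = a i"
        using a_Z by (auto simp: Z_def)
      have "i \<le> j"
      proof (cases "j < p")
        case True
        then have "a i \<le> a j"
          using L(3) 3 i by (auto simp: K_def)
        then show ?thesis
          using a_le i by blast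
      qed (use i in auto)
      moreover have "j \<le> Suc i"
      proof (cases j)
        case (Suc j')
        then have "a j' \<le> a i"
          using L(2) 3 i j by (auto simp: K_def)
        then show ?thesis
          using a_le[of j' i] j Suc by simp
      qed simp
      ultimately consider "j = i" | "j = Suc i"
        by linarith
      then show ?thesis
        using 3 i by cases (auto simp: K_def)
    qed
  qed
  moreover have "p + 1 \<le> 3"
    using Z by simp
  ultimately show ?thesis
    by blast
qed

end

theorem theorem3p4:
  fixes h l m0 :: complex
  assumes "h \<notin> {2 * of_real pi * \<i> * r | r. r \<in> \<rat>}"
    and "\<forall>k::int. qpow h (2 * m0 + of_int k) \<noteq> -1"
  shows "\<exists>n\<le>3. has_length (Uq_tw_so3 h) (Vrep h l m0) n"
proof -
  interpret so3_rep h l m0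
    using assms by unfold_locales
  show ?thesis
    by (rule length_at_most_3)
qed

end
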